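(* Consider $n$ jobs on a single machine with weights $w_j\ge0$, release dates $r_j\ge0$, independent non-negative random processing times $\bm p_j$ with $\bar p_j=\mathrm E[\bm p_j]>0$, indexed so that $w_1/\bar p_1\ge\cdots\ge w_n/\bar p_n$, and assume all processing times are $\delta$-NBUE for some $\delta\ge1$. Let $f$ be a probability density function on $(0,1]$ and $c\in\mathbb R$ such that for every $x\in(0,1]$: (1) $\int_0^x\frac{\delta}{\delta+x-\alpha}f(\alpha)\,\mathrm d\alpha\le(c-1)x$; (2) $\bigl(1+\int_0^1\frac{\delta}{\delta+1-\alpha}f(\alpha)\,\mathrm d\alpha\bigr)\int_{1-x}^1f(\alpha)\,\mathrm d\alpha\le cx$. Then \[\mathrm E\Bigl[\sum_{j=1}^nw_j\bm C_j^{\mathrm{RSOS}(f)}\Bigr]\le c\sum_{j=1}^nw_j\Bigl(M_j^{\mathrm{S^p}}+\frac{\bar p_j}2\Bigr)\le c\,\mathrm E\Bigl[\sum_{j=1}^nw_j\bm C_j^{\mathrm{OPT}}\Bigr],\] where $\mathrm{OPT}$ is an optimal (non-preemptive, non-anticipative) scheduling policy.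
   Context: A non-negative random variable $\bm X$ is $\delta$-NBUE if $\mathrm E[\bm X-t\mid\bm X>t]\le\delta\,\mathrm E[\bm X]$ for all $t\ge0$. Scheduling policies are non-preemptive, never start $j$ before $r_j$, and are non-anticipative. $\mathrm{S^p}$ is the preemptive WSPT schedule of the deterministic counterparts (processing times $\bar p_j$): at each time the released unfinished job of smallest index is processed; $I_j^{\mathrm{S^p}}(t)\in\{0,1\}$ indicates processing of $j$ at $t$; $M_j^{\mathrm{S^p}}:=\frac1{\bar p_j}\int_0^\infty I_j^{\mathrm{S^p}}(t)t\,\mathrm dt$; the $\alpha$-point is $C_j(\alpha):=\min\{t\ge0:\int_0^tI_j^{\mathrm{S^p}}(s)\mathrm ds\ge\alpha\bar p_j\}$. The $\mathrm{RSOS}(f)$ policy: at release of $j$ draw $\bm\alpha_j\in(0,1]$ with density $f$, independently of everything else; construct $\mathrm{S^p}$ virtually over time; append $j$ to a FIFO queue at time $C_j(\bm\alpha_j)$; the machine processes the queue in FIFO order without idling while the queue is nonempty. *)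

theory Defs
  imports "HOL-Probability.Probability"
begin

definition delta_NBUE :: "'a measure \<Rightarrow> real \<Rightarrow> ('a \<Rightarrow> real) \<Rightarrow> bool" where
  "delta_NBUE M \<delta> X \<longleftrightarrow>
     (\<forall>t\<ge>0. measure M {\<omega> \<in> space M. X \<omega> > t} > 0 \<longrightarrow>
        (LINT \<omega>:{\<omega> \<in> space M. X \<omega> > t}|M. X \<omega> - t) / measure M {\<omega> \<in> space M. X \<omega> > t}
          \<le> \<delta> * (LINT \<omega>|M. X \<omega>))"

definition pdf_on_unit :: "(real \<Rightarrow> real) \<Rightarrow> bool" where
  "pdf_on_unit f \<longleftrightarrow> set_integrable lborel {0<..1} f \<and> (\<forall>x\<in>{0<..1}. 0 \<le> f x)
     \<and> (LBINT x:{0<..1}. f x) = 1"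


subsection \<open>The virtual preemptive WSPT schedule\<close>

text \<open>
  \<open>sp_pending r q j t\<close> says that job \<open>j\<close> is released and unfinished at time \<open>t\<close> in the preemptive
  schedule with release dates \<open>r\<close> and processing times \<open>q\<close> in which smaller indices have priority.
  To obtain a recursion on the index, the work done on \<open>j\<close> until \<open>t\<close> is expressed by the amount
  of time in \<open>[r j, t]\<close> during which no job of smaller index is pending (this is the work done on
  \<open>j\<close>, up to truncation at \<open>q j\<close>). Lemmas \<open>sp_pending_iff\<close> and \<open>sp_ind_iff_Min\<close> below recover the
  usual description: at each time the released unfinished job of smallest index is processed.
\<close>

fun sp_pending :: "(nat \<Rightarrow> real) \<Rightarrow> (nat \<Rightarrow> real) \<Rightarrow> nat \<Rightarrow> real \<Rightarrow> bool" where
  "sp_pending r q j t \<longleftrightarrow> r j \<le> t \<and>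
     measure lborel {s \<in> {r j..t}. \<forall>k\<in>{1..<j}. \<not> sp_pending r q k s} < q j"

declare sp_pending.simps [simp del]

definition sp_ind :: "(nat \<Rightarrow> real) \<Rightarrow> (nat \<Rightarrow> real) \<Rightarrow> nat \<Rightarrow> real \<Rightarrow> real" where
  "sp_ind r q j t = of_bool (sp_pending r q j t \<and> (\<forall>k\<in>{1..<j}. \<not> sp_pending r q k t))"

definition sp_mean_busy_time :: "(nat \<Rightarrow> real) \<Rightarrow> (nat \<Rightarrow> real) \<Rightarrow> nat \<Rightarrow> real" where
  "sp_mean_busy_time r q j = 1 / q j * (LBINT t:{0..}. sp_ind r q j t * t)"

definition alpha_point :: "(nat \<Rightarrow> real) \<Rightarrow> (nat \<Rightarrow> real) \<Rightarrow> nat \<Rightarrow> real \<Rightarrow> real" where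
  "alpha_point r q j \<alpha> = (LEAST t. 0 \<le> t \<and> (LBINT s:{0..t}. sp_ind r q j s) \<ge> \<alpha> * q j)"

lemma sets_sp_pending: "{s. sp_pending r q j s} \<in> sets lborel"
proof (induction j rule: less_induct)
  case (less j)
  define F where "F = {s. \<forall>k\<in>{1..<j}. \<not> sp_pending r q k s}"
  have F: "F \<in> sets lborel"
  proof -
    have "F = space lborel - (\<Union>k\<in>{1..<j}. {s. sp_pending r q k s})" by (auto simp: F_def)
    then show ?thesis using less by (auto intro!: sets.Diff sets.finite_UN)
  qed
  have eq: "{s \<in> {r j..t}. \<forall>k\<in>{1..<j}. \<not> sp_pending r q k s} = {r j..t} \<inter> F" for t
    by (auto simp: F_def)
  have "mono (\<lambda>t. measure lborel ({r j..t} \<inter> F))"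
  proof (rule monoI)
    fix s t :: real assume "s \<le> t"
    have "emeasure lborel ({r j..t} \<inter> F) \<le> emeasure lborel {r j..t}"
      using F by (intro emeasure_mono) auto
    also have "\<dots> < \<infinity>" by (simp add: emeasure_lborel_Icc_eq)
    finally have "{r j..t} \<inter> F \<in> fmeasurable lborel" using F by (intro fmeasurableI) auto
    then show "measure lborel ({r j..s} \<inter> F) \<le> measure lborel ({r j..t} \<inter> F)"
      using F \<open>s \<le> t\<close> by (intro measure_mono_fmeasurable) auto
  qed
  then have [measurable]: "(\<lambda>t. measure lborel ({r j..t} \<inter> F)) \<in> borel_measurable borel"
    by (rule borel_measurable_mono)
  show ?case
    by (subst sp_pending.simps, unfold eq) measurable
qed

lemma sp_pending_iff:
  assumes "0 \<le> r j" and "0 < q j"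
  shows "sp_pending r q j t \<longleftrightarrow> r j \<le> t \<and> (LBINT s:{0..t}. sp_ind r q j s) < q j"
proof (cases "r j \<le> t")
  case False
  then show ?thesis by (subst sp_pending.simps) simp
next
  case True
  define F where "F = {s. \<forall>k\<in>{1..<j}. \<not> sp_pending r q k s}"
  define W where "W = (\<lambda>t. measure lborel ({r j..t} \<inter> F))"
  have F [measurable]: "F \<in> sets lborel"
  proof -
    have "F = space lborel - (\<Union>k\<in>{1..<j}. {s. sp_pending r q k s})" by (auto simp: F_def)
    then show ?thesis using sets_sp_pending by (auto intro!: sets.Diff sets.finite_UN)
  qed
  have eq: "{s \<in> {r j..t}. \<forall>k\<in>{1..<j}. \<not> sp_pending r q k s} = {r j..t} \<inter> F" for t
    by (auto simp: F_def)
  have pend: "sp_pending r q j s \<longleftrightarrow> r j \<le> s \<and> W s < q j" for s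
    by (subst sp_pending.simps, unfold eq W_def) simp
  have fm: "A \<inter> F \<in> fmeasurable lborel" if "A \<subseteq> {a..b}" "A \<in> sets lborel" for A and a b :: real
  proof (rule fmeasurableI)
    show "A \<inter> F \<in> sets lborel" using that(2) F by (rule sets.Int)
    have "emeasure lborel (A \<inter> F) \<le> emeasure lborel {a..b}"
      using that F by (intro emeasure_mono) auto
    also have "\<dots> < \<infinity>" by (simp add: emeasure_lborel_Icc_eq)
    finally show "emeasure lborel (A \<inter> F) < \<infinity>" .
  qed
  have diff: "W b = W a + measure lborel ({a<..b} \<inter> F)" if "r j \<le> a" "a \<le> b" for a b
  proof -
    have "{r j..b} \<inter> F = ({r j..a} \<inter> F) \<union> ({a<..b} \<inter> F)" using that by auto
    moreover have "measure lborel (({r j..a} \<inter> F) \<union> ({a<..b} \<inter> F)) =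
        measure lborel ({r j..a} \<inter> F) + measure lborel ({a<..b} \<inter> F)"
      using that by (intro measure_Un_AE fm[of _ "r j" b]) auto
    ultimately show ?thesis by (simp add: W_def)
  qed
  have lip: "W a \<le> W b \<and> W b \<le> W a + (b - a)" if "r j \<le> a" "a \<le> b" for a b
  proof -
    have "measure lborel ({a<..b} \<inter> F) \<le> measure lborel {a..b}"
      using F by (intro measure_mono_fmeasurable) (auto intro!: fmeasurableI simp: emeasure_lborel_Icc_eq)
    then show ?thesis using diff[OF that] that by simp
  qed
  have W0: "W (r j) = 0"
  proof -
    have "measure lborel ({r j..r j} \<inter> F) \<le> measure lborel {r j..r j}"
      using F by (intro measure_mono_fmeasurable) (auto intro!: fmeasurableI simp: emeasure_lborel_Icc_eq)
    then show ?thesis by (simp add: W_def measure_le_0_iff)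
  qed
  have cont: "continuous_on {r j..t} W"
  proof (rule lipschitz_on_continuous_on[where L=1], rule lipschitz_onI)
    fix a b assume "a \<in> {r j..t}" "b \<in> {r j..t}"
    then show "dist (W a) (W b) \<le> 1 * dist a b"
      using lip[of a b] lip[of b a] by (cases "a \<le> b") (auto simp: dist_real_def abs_real_def)
  qed simp
  have "(LBINT s:{0..t}. sp_ind r q j s) = (LBINT s. indicator ({s\<in>{r j..t}. W s < q j} \<inter> F) s)"
    unfolding set_lebesgue_integral_def
    by (intro Bochner_Integration.integral_cong refl)
       (use assms(1) in \<open>auto simp: sp_ind_def pend F_def indicator_def\<close>)
  also have "\<dots> = measure lborel ({s\<in>{r j..t}. W s < q j} \<inter> F)" by simp
  finally have int: "(LBINT s:{0..t}. sp_ind r q j s) = measure lborel ({s\<in>{r j..t}. W s < q j} \<inter> F)" .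
  show ?thesis
  proof (cases "W t < q j")
    case lt: True
    have "{s\<in>{r j..t}. W s < q j} = {r j..t}" using lip lt True by fastforce
    then show ?thesis using int lt True pend by (simp add: W_def)
  next
    case ge: False
    obtain T where T: "r j \<le> T" "T \<le> t" "W T = q j"
      using IVT'[of W "r j" "q j" t] W0 assms ge True cont by auto
    define B where "B = {s\<in>{r j..t}. W s < q j}"
    have Bm: "B \<in> sets lborel"
    proof -
      have "B = {r j..t} \<inter> {s. sp_pending r q j s}" by (auto simp: B_def pend)
      then show ?thesis using sets_sp_pending[of r q j] by auto
    qed
    define T0 where "T0 = Sup B"
    have Bne: "r j \<in> B" using True W0 assms by (auto simp: B_def)
    have Bup: "s < T" if "s \<in> B" for s using that lip[of T s] T by (force simp: B_def)
    have Bbd: "bdd_above B" using Bup by (intro bdd_aboveI[of _ T]) (auto intro: less_imp_le)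
    have T0: "r j \<le> T0" "T0 \<le> T"
      unfolding T0_def using Bne Bup Bbd cSup_upper[of "r j" B] cSup_least[of B T]
      by (auto intro: less_imp_le)
    have sub: "{r j..<T0} \<subseteq> B"
    proof
      fix s assume s: "s \<in> {r j..<T0}"
      then obtain b where "b \<in> B" "s < b" using Bne less_cSupE[of s B] unfolding T0_def by auto
      then show "s \<in> B" using lip[of s b] s by (auto simp: B_def)
    qed
    have "W T0 \<ge> q j"
    proof (rule ccontr)
      assume nle: "\<not> q j \<le> W T0"
      define e where "e = min ((q j - W T0) / 2) (T - T0)"
      have "e \<le> T - T0" by (simp add: e_def)
      have "T0 \<noteq> T" using T nle by auto
      then have "e > 0" using T0 nle by (auto simp: e_def)
      have "W (T0 + e) \<le> W T0 + e" using lip[of T0 "T0 + e"] T0 \<open>e > 0\<close> by auto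
      also have "\<dots> < q j" using nle by (auto simp: e_def min_def field_simps split: if_splits)
      finally have "T0 + e \<in> B" using T0 T \<open>e > 0\<close> \<open>e \<le> T - T0\<close> by (auto simp: B_def)
      then have "T0 + e \<le> T0" unfolding T0_def
        using Bbd by (rule cSup_upper)
      then show False using \<open>e > 0\<close> by simp
    qed
    also have "W T0 \<le> measure lborel ((B \<inter> F) \<union> {T0})"
      unfolding W_def
    proof (rule measure_mono_fmeasurable)
      show "{r j..T0} \<inter> F \<subseteq> B \<inter> F \<union> {T0}" using sub by force
      show "{r j..T0} \<inter> F \<in> sets lborel" using F by auto
      have "B \<inter> F \<in> fmeasurable lborel" using Bm by (intro fm[of B "r j" t]) (auto simp: B_def)
      then show "B \<inter> F \<union> {T0} \<in> fmeasurable lborel"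
        by (rule fmeasurable.Un) (auto intro!: fmeasurableI)
    qed
    also have "\<dots> \<le> measure lborel (B \<inter> F) + measure lborel {T0}"
      by (rule measure_Un_le) (use Bm F in auto)
    finally have "q j \<le> measure lborel (B \<inter> F)" by simp
    then show ?thesis using int ge pend by (simp add: B_def)
  qed
qed

lemma sp_ind_iff_Min:
  assumes "\<And>j. j \<in> {1..n} \<Longrightarrow> 0 \<le> r j" and "\<And>j. j \<in> {1..n} \<Longrightarrow> 0 < q j" and "j \<in> {1..n}"
  defines "U \<equiv> \<lambda>t. {k \<in> {1..n}. r k \<le> t \<and> (LBINT s:{0..t}. sp_ind r q k s) < q k}"
  shows "sp_ind r q j t = (if U t \<noteq> {} \<and> j = Min (U t) then 1 else 0)"
proof -
  have U: "U t = {k \<in> {1..n}. sp_pending r q k t}"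
    using assms(1,2) by (auto simp: U_def sp_pending_iff)
  have fin: "finite (U t)" by (simp add: U)
  have "U t \<noteq> {} \<and> j = Min (U t) \<longleftrightarrow> j \<in> U t \<and> (\<forall>k\<in>U t. j \<le> k)"
    using fin by (metis Min_eqI Min_in Min_le empty_iff)
  also have "\<dots> \<longleftrightarrow> sp_pending r q j t \<and> (\<forall>k\<in>{1..<j}. \<not> sp_pending r q k t)"
    using assms(3) by (auto simp: U not_less[symmetric])
  finally show ?thesis by (simp add: sp_ind_def)
qed


subsection \<open>The RSOS policy\<close>

text \<open>
  \<open>fifo_completion a x t js\<close>: the machine is free from time \<open>t\<close> on, the jobs \<open>js\<close> (listed in the order
  of their queue entry times \<open>a\<close>) are still to be processed, and \<open>x\<close> are the processing times.
\<close>

fun fifo_completion :: "(nat \<Rightarrow> real) \<Rightarrow> (nat \<Rightarrow> real) \<Rightarrow> real \<Rightarrow> nat list \<Rightarrow> nat \<Rightarrow> real" where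
  "fifo_completion a x t [] = (\<lambda>_. 0)"
| "fifo_completion a x t (j # js) =
     (let C = max t (a j) + x j in (fifo_completion a x C js)(j := C))"

text \<open>
  Distinct jobs never enter the queue simultaneously for \<open>\<alpha> j \<in> (0,1]\<close>, so the order in which
  \<^const>\<open>sort_key\<close> puts equal keys is immaterial.
\<close>

definition rsos_completion ::
  "nat \<Rightarrow> (nat \<Rightarrow> real) \<Rightarrow> (nat \<Rightarrow> real) \<Rightarrow> (nat \<Rightarrow> real) \<Rightarrow> (nat \<Rightarrow> real) \<Rightarrow> nat \<Rightarrow> real" where
  "rsos_completion n r q \<alpha> x =
     (let a = (\<lambda>j. alpha_point r q j (\<alpha> j))
      in fifo_completion a x 0 (sort_key a [1..<Suc n]))"

definition rsos_cost ::
  "nat \<Rightarrow> (nat \<Rightarrow> real) \<Rightarrow> (nat \<Rightarrow> real) \<Rightarrow> 'a measure \<Rightarrow> (nat \<Rightarrow> 'a \<Rightarrow> real) \<Rightarrow> (real \<Rightarrow> real) \<Rightarrow> ennreal" where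
  "rsos_cost n w r M p f =
     (\<integral>\<^sup>+ (\<omega>, \<alpha>). ennreal (\<Sum>j=1..n. w j *
          rsos_completion n r (\<lambda>k. LINT \<omega>'|M. p k \<omega>') \<alpha> (\<lambda>k. p k \<omega>) j)
      \<partial>(M \<Otimes>\<^sub>M PiM {1..n} (\<lambda>_. density lborel (\<lambda>y. ennreal (indicator {0<..1} y * f y)))))"


subsection \<open>Scheduling policies\<close>

text \<open>
  On a single machine without preemption no job can be started while another one is running, and
  no information is revealed while the machine is idle (release dates are fixed). A non-anticipative
  policy therefore decides, initially and after each completion, which job to start next and at
  which time, on the basis of the jobs completed so far with their start times and observed
  processing times (listed in chronological order). Policies may be randomized: the first argument
  is a random seed, drawn uniformly from \<open>[0,1]\<close> independently of the processing times.
  Measurability is only required of the resulting completion times.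
\<close>

type_synonym history = "(nat \<times> real \<times> real) list"
type_synonym policy = "real \<Rightarrow> history \<Rightarrow> nat \<times> real"

primrec run :: "policy \<Rightarrow> real \<Rightarrow> (nat \<Rightarrow> real) \<Rightarrow> nat \<Rightarrow> history" where
  "run \<pi> u x 0 = []"
| "run \<pi> u x (Suc m) =
     (let h = run \<pi> u x m; (j, s) = \<pi> u h in h @ [(j, s, x j)])"

definition completion :: "policy \<Rightarrow> real \<Rightarrow> (nat \<Rightarrow> real) \<Rightarrow> nat \<Rightarrow> nat \<Rightarrow> real" where
  "completion \<pi> u x n j = (let (s, y) = the (map_of (run \<pi> u x n) j) in s + y)"

definition scheduling_policy :: "nat \<Rightarrow> (nat \<Rightarrow> real) \<Rightarrow> policy \<Rightarrow> bool" where
  "scheduling_policy n r \<pi> \<longleftrightarrow>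
     (\<forall>u\<in>{0..1}. \<forall>x. (\<forall>j\<in>{1..n}. 0 \<le> x j) \<longrightarrow>
        (let h = run \<pi> u x n in
           distinct (map fst h) \<and> set (map fst h) = {1..n} \<and>
           (\<forall>(j, s, y)\<in>set h. r j \<le> s) \<and>
           sorted_wrt (\<lambda>(i, s, y) (j, s', y'). s + y \<le> s') h)) \<and>
     (\<forall>j\<in>{1..n}. (\<lambda>(u, x). completion \<pi> u x n j)
        \<in> borel_measurable (borel \<Otimes>\<^sub>M PiM {1..n} (\<lambda>_. borel)))"

text \<open>Policies exist: the jobs can be processed in the order of their indices.\<close>

lemma scheduling_policy_exists: "\<exists>\<pi>. scheduling_policy n r \<pi>"
proof -
  define \<pi> :: policy where "\<pi> = (\<lambda>u h. (Suc (length h),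
     max (if h = [] then 0 else case last h of (j, s, y) \<Rightarrow> s + y) (r (Suc (length h)))))"
  define c :: "(nat \<Rightarrow> real) \<Rightarrow> nat \<Rightarrow> real"
    where "c = (\<lambda>x. rec_nat 0 (\<lambda>m C. max C (r (Suc m)) + x (Suc m)))"
  have c0: "c x 0 = 0" and cS: "c x (Suc m) = max (c x m) (r (Suc m)) + x (Suc m)" for x m
    by (simp_all add: c_def)
  define g where "g = (\<lambda>x i. (Suc i, max (c x i) (r (Suc i)), x (Suc i)))"
  have run: "run \<pi> u x m = map (g x) [0..<m]" for u x m
  proof (induction m)
    case (Suc m)
    then show ?case by (cases m) (auto simp: \<pi>_def g_def c0 cS Let_def)
  qed simp
  have mono: "c x i \<le> c x k" if "\<forall>j\<in>{1..n}. 0 \<le> x j" "i \<le> k" "k \<le> n" for x i k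
    using that(2,3)
  proof (induction k rule: dec_induct)
    case (step k)
    then show ?case using that(1)[rule_format, of "Suc k"] by (simp add: cS)
  qed simp
  have fst: "map fst (run \<pi> u x n) = [1..<Suc n]" for u x
    by (simp add: run g_def comp_def map_Suc_upt[symmetric] del: upt_Suc)
  have comp: "completion \<pi> u x n j = c x j" if "j \<in> {1..n}" for u x j
  proof -
    have "g x (j - 1) \<in> set (run \<pi> u x n)" using that by (auto simp: run)
    moreover have "distinct (map fst (run \<pi> u x n))" by (simp only: fst distinct_upt)
    ultimately have "map_of (run \<pi> u x n) j = Some (snd (g x (j - 1)))"
      using that by (intro map_of_is_SomeI) (auto simp: g_def)
    then show ?thesis using that by (cases j) (auto simp: completion_def g_def cS)
  qed
  have cm: "j \<le> n \<Longrightarrow> (\<lambda>(u::real, x). c x j) \<in> borel_measurable (borel \<Otimes>\<^sub>M PiM {1..n} (\<lambda>_. borel))"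
    for j
  proof (induction j)
    case (Suc j)
    have [measurable]: "(\<lambda>z::real \<times> _. c (snd z) j) \<in> borel_measurable (borel \<Otimes>\<^sub>M PiM {1..n} (\<lambda>_. borel))"
      using Suc by (simp add: case_prod_beta')
    have [measurable]: "Suc j \<in> {1..n}" using Suc by simp
    show ?case unfolding case_prod_beta' cS by measurable
  qed (simp add: c0)
  have "scheduling_policy n r \<pi>"
    unfolding scheduling_policy_def Let_def
  proof (intro conjI ballI allI impI)
    fix u :: real and x :: "nat \<Rightarrow> real" assume x: "\<forall>j\<in>{1..n}. 0 \<le> x j"
    show "distinct (map fst (run \<pi> u x n))" "set (map fst (run \<pi> u x n)) = {1..n}"
      by (simp_all only: fst distinct_upt set_upt atLeastLessThanSuc_atLeastAtMost)
    show "case z of (j, s, y) \<Rightarrow> r j \<le> s" if "z \<in> set (run \<pi> u x n)" for z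
      using that by (auto simp: run g_def)
    show "sorted_wrt (\<lambda>(i, s, y) (j, s', y'). s + y \<le> s') (run \<pi> u x n)"
      unfolding run sorted_wrt_map
    proof (rule sorted_wrt_mono_rel[OF _ sorted_wrt_upt])
      fix i k assume "i \<in> set [0..<n]" "k \<in> set [0..<n]" "i < k"
      then show "(case g x i of (i, s, y) \<Rightarrow> \<lambda>(j, s', y'). s + y \<le> s') (g x k)"
        using mono[OF x, of "Suc i" k] by (simp add: g_def cS)
    qed
  next
    fix j assume j: "j \<in> {1..n}"
    then show "(\<lambda>(u, x). completion \<pi> u x n j)
        \<in> borel_measurable (borel \<Otimes>\<^sub>M PiM {1..n} (\<lambda>_. borel))"
      using cm[of j] by (simp add: comp)
  qed
  then show ?thesis by blast
qed

definition policy_cost ::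
  "nat \<Rightarrow> (nat \<Rightarrow> real) \<Rightarrow> 'a measure \<Rightarrow> (nat \<Rightarrow> 'a \<Rightarrow> real) \<Rightarrow> policy \<Rightarrow> ennreal" where
  "policy_cost n w M p \<pi> =
     (\<integral>\<^sup>+ (u, \<omega>). ennreal (\<Sum>j=1..n. w j * completion \<pi> u (\<lambda>k\<in>{1..n}. p k \<omega>) n j)
      \<partial>(uniform_measure lborel {0..1} \<Otimes>\<^sub>M M))"

definition optimal_policy ::
  "nat \<Rightarrow> (nat \<Rightarrow> real) \<Rightarrow> (nat \<Rightarrow> real) \<Rightarrow> 'a measure \<Rightarrow> (nat \<Rightarrow> 'a \<Rightarrow> real) \<Rightarrow> policy \<Rightarrow> bool" where
  "optimal_policy n w r M p \<pi> \<longleftrightarrow> scheduling_policy n r \<pi> \<and>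
     (\<forall>\<sigma>. scheduling_policy n r \<sigma> \<longrightarrow> policy_cost n w M p \<pi> \<le> policy_cost n w M p \<sigma>)"

end

theory Submission imports Defs begin

text \<open>
  Fix a job \<open>j\<close> and let \<open>a\<close> be its \<open>\<alpha>\<close>-point in the preemptive schedule. FIFO service and the
  unit speed of the virtual machine show that \<open>j\<close> completes no later than
  \<open>a + p\<^sub>j + \<Sum>\<^sub>k (p\<^sub>k - (\<eta>\<^sub>k - \<alpha>\<^sub>k) q\<^sub>k)\<^sup>+\<close>, where \<open>\<eta>\<^sub>k\<close> is the fraction of \<open>k\<close> that is virtually
  processed by time \<open>a\<close> and \<open>k\<close> ranges over the other jobs with \<open>\<alpha>\<^sub>k \<le> \<eta>\<^sub>k\<close>. By the NBUE property
  the expectation of each summand is at most \<open>q\<^sub>k \<delta> / (\<delta> + \<eta>\<^sub>k - \<alpha>\<^sub>k)\<close>. As a function of \<open>\<alpha>\<^sub>j\<close>, the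
  fraction \<open>\<eta>\<^sub>k\<close> is constant for \<open>k > j\<close> and a monotone 0-1 step function for \<open>k < j\<close>, and so is
  handled by the first and the second condition on \<open>f\<close>, respectively; since
  \<open>a = idle + \<Sum>\<^sub>k q\<^sub>k \<eta>\<^sub>k\<close> with a constant idle time and the mean busy time is the average
  \<open>\<alpha>\<close>-point, this gives \<open>E C\<^sub>j \<le> c (M\<^sub>j + q\<^sub>j / 2)\<close> job by job.

  For the lower bound, a start time \<open>S\<^sub>j\<close> is independent of \<open>p\<^sub>j\<close>, so taking expectations in
  \<open>\<Sum>\<^sub>B p\<^sub>j S\<^sub>j \<ge> l \<Sum>\<^sub>B p\<^sub>j + \<Sum>\<^bsub>i<j\<^esub> p\<^sub>i p\<^sub>j\<close>, valid for every set \<open>B\<close> of jobs not released before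
  \<open>l\<close>, yields a bound on \<open>\<Sum>\<^sub>B q\<^sub>j (E S\<^sub>j + q\<^sub>j / 2)\<close> that the preemptive schedule attains on each busy period of
  each set \<open>{1..i}\<close>. Writing the weights as nonnegative combinations of these prefixes finishes
  the proof.
\<close>

subsection \<open>Measure and probability\<close>

lemma fmeasurable_Ioc [simp]: "{a<..b::real} \<in> fmeasurable lborel"
  by (cases "a \<le> b") (auto intro!: fmeasurableI)

lemma (in sigma_finite_measure) set_nn_integral_layer_cake:
  fixes g :: "'a \<Rightarrow> real"
  assumes [measurable]: "A \<in> sets M" "g \<in> borel_measurable M"
  shows "(\<integral>\<^sup>+x\<in>A. ennreal (g x) \<partial>M)
    = (\<integral>\<^sup>+s\<in>{0..}. emeasure M (A \<inter> {x \<in> space M. s < g x}) \<partial>lborel)"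
proof -
  interpret pair_sigma_finite lborel M ..
  define I :: "real \<Rightarrow> 'a \<Rightarrow> ennreal"
    where "I = (\<lambda>s x. indicator {(s, x). 0 \<le> s \<and> s < g x} (s, x) * indicator A x)"
  have [measurable]: "case_prod I \<in> borel_measurable (lborel \<Otimes>\<^sub>M M)"
    unfolding I_def by measurable
  have inner_s: "ennreal (g x) * indicator A x = (\<integral>\<^sup>+s. I s x \<partial>lborel)" for x
  proof -
    have "(\<integral>\<^sup>+s. I s x \<partial>lborel) = (\<integral>\<^sup>+s. indicator {0..<g x} s * indicator A x \<partial>lborel)"
      by (intro nn_integral_cong) (auto simp: I_def indicator_def)
    also have "\<dots> = ennreal (g x) * indicator A x"
      by (cases "0 \<le> g x") (simp_all add: nn_integral_multc ennreal_neg)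
    finally show ?thesis ..
  qed
  have inner_x: "emeasure M (A \<inter> {x \<in> space M. s < g x}) * indicator {0..} s
      = (\<integral>\<^sup>+x. I s x \<partial>M)" for s
  proof -
    have "(\<integral>\<^sup>+x. I s x \<partial>M)
        = (\<integral>\<^sup>+x. indicator (A \<inter> {x \<in> space M. s < g x}) x * indicator {0..} s \<partial>M)"
      by (intro nn_integral_cong) (auto simp: I_def indicator_def)
    then show ?thesis by (simp add: nn_integral_multc)
  qed
  show ?thesis
    unfolding inner_s inner_x by (rule Fubini') measurable
qed

lemma set_nn_integral_Icc_ident:
  assumes "0 \<le> a" "a \<le> b"
  shows "(\<integral>\<^sup>+t\<in>{a..b}. ennreal t \<partial>lborel) = ennreal ((b\<^sup>2 - a\<^sup>2) / 2)"
  using assms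
  by (subst nn_integral_FTC_Icc[where F="\<lambda>x. x\<^sup>2 / 2"])
     (auto intro!: derivative_eq_intros simp: diff_divide_distrib)

lemma nn_integral_PiM_component:
  assumes "\<And>i. i \<in> I \<Longrightarrow> prob_space (M i)" "j \<in> I" "g \<in> borel_measurable (M j)"
  shows "(\<integral>\<^sup>+x. g (x j) \<partial>PiM I M) = (\<integral>\<^sup>+a. g a \<partial>M j)"
proof -
  have "(\<integral>\<^sup>+a. g a \<partial>M j) = (\<integral>\<^sup>+a. g a \<partial>distr (PiM I M) (M j) (\<lambda>x. x j))"
    using assms(1,2) by (simp only: distr_PiM_component)
  also have "\<dots> = (\<integral>\<^sup>+x. g (x j) \<partial>PiM I M)"
    using assms(2,3) by (intro nn_integral_distr) auto
  finally show ?thesis ..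
qed

lemma nn_integral_PiM_two_components:
  assumes M: "\<And>i. prob_space (M i)" and I: "finite I" "j \<in> I" "k \<in> I" "j \<noteq> k"
    and [measurable]: "case_prod g \<in> borel_measurable (M j \<Otimes>\<^sub>M M k)"
  shows "(\<integral>\<^sup>+x. g (x j) (x k) \<partial>PiM I M) = (\<integral>\<^sup>+a. \<integral>\<^sup>+b. g a b \<partial>M k \<partial>M j)"
proof -
  interpret prob_space "M i" for i by (rule M)
  interpret product_sigma_finite M ..
  define J where "J = I - {k}"
  have J: "finite J" "k \<notin> J" "j \<in> J" "I = insert k J" using I by (auto simp: J_def)
  have [measurable]: "j \<in> J" by fact
  have "(\<integral>\<^sup>+x. g (x j) (x k) \<partial>PiM I M)
      = (\<integral>\<^sup>+x. \<integral>\<^sup>+b. g ((x(k := b)) j) ((x(k := b)) k) \<partial>M k \<partial>PiM J M)"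
    unfolding J(4) using J by (intro product_nn_integral_insert) measurable
  also have "\<dots> = (\<integral>\<^sup>+x. \<integral>\<^sup>+b. g (x j) b \<partial>M k \<partial>PiM J M)"
    using I(4) by simp
  also have "\<dots> = (\<integral>\<^sup>+a. \<integral>\<^sup>+b. g a b \<partial>M k \<partial>M j)"
    using M J by (intro nn_integral_PiM_component[where g="\<lambda>a. \<integral>\<^sup>+b. g a b \<partial>M k"]) measurable
  finally show ?thesis .
qed

lemma (in prob_space) nn_integral_mult_indep_var:
  assumes indep: "indep_var S X T Y"
    and [measurable]: "f \<in> borel_measurable S" "g \<in> borel_measurable T"
  shows "(\<integral>\<^sup>+\<omega>. f (X \<omega>) * g (Y \<omega>) \<partial>M) = (\<integral>\<^sup>+\<omega>. f (X \<omega>) \<partial>M) * (\<integral>\<^sup>+\<omega>. g (Y \<omega>) \<partial>M)"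
proof -
  have [measurable]: "X \<in> M \<rightarrow>\<^sub>M S" "Y \<in> M \<rightarrow>\<^sub>M T"
    and distr: "distr M (S \<Otimes>\<^sub>M T) (\<lambda>\<omega>. (X \<omega>, Y \<omega>)) = distr M S X \<Otimes>\<^sub>M distr M T Y"
    using indep unfolding indep_var_distribution_eq by auto
  interpret Y: prob_space "distr M T Y" by (rule prob_space_distr) measurable
  have "(\<integral>\<^sup>+\<omega>. f (X \<omega>) * g (Y \<omega>) \<partial>M)
      = (\<integral>\<^sup>+z. f (fst z) * g (snd z) \<partial>distr M (S \<Otimes>\<^sub>M T) (\<lambda>\<omega>. (X \<omega>, Y \<omega>)))"
    by (subst nn_integral_distr) auto
  also have "\<dots> = (\<integral>\<^sup>+x. \<integral>\<^sup>+y. f x * g y \<partial>distr M T Y \<partial>distr M S X)"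
    unfolding distr by (subst Y.nn_integral_fst[symmetric]) auto
  also have "\<dots> = (\<integral>\<^sup>+x. f x \<partial>distr M S X) * (\<integral>\<^sup>+y. g y \<partial>distr M T Y)"
    by (simp add: nn_integral_cmult nn_integral_multc)
  finally show ?thesis by (simp add: nn_integral_distr)
qed

lemma (in prob_space) indep_var_restrict_others:
  assumes "indep_vars M' X I" "j \<in> I" "G \<in> PiM (I - {j}) M' \<rightarrow>\<^sub>M N"
  shows "indep_var (M' j) (X j) N (\<lambda>\<omega>. G (\<lambda>k\<in>I - {j}. X k \<omega>))"
proof -
  have "indep_var (M' j) ((\<lambda>x. x j) \<circ> (\<lambda>\<omega>. \<lambda>k\<in>{j}. X k \<omega>)) N (G \<circ> (\<lambda>\<omega>. \<lambda>k\<in>I - {j}. X k \<omega>))"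
    using assms(2,3) by (intro indep_var_compose[OF indep_var_restrict[OF assms(1)]]) auto
  then show ?thesis by (simp add: comp_def)
qed

subsection \<open>Finite sums\<close>

lemma sum_antimono_weights_mono:
  fixes a b v :: "nat \<Rightarrow> ennreal"
  assumes "\<And>i. i \<in> {1..n} \<Longrightarrow> sum a {1..i} \<le> sum b {1..i}"
    and "\<And>i j. 1 \<le> i \<Longrightarrow> i \<le> j \<Longrightarrow> j \<le> n \<Longrightarrow> v j \<le> v i"
  shows "(\<Sum>j=1..n. v j * a j) \<le> (\<Sum>j=1..n. v j * b j)"
  using assms
proof (induction n arbitrary: v)
  case (Suc n)
  define z where "z = v (Suc n)"
  have Abel: "(\<Sum>j=1..Suc n. v j * g j) = (\<Sum>j=1..n. (v j - z) * g j) + z * sum g {1..Suc n}"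
    for g :: "nat \<Rightarrow> ennreal"
  proof -
    have "v j * g j = (v j - z) * g j + z * g j" if "j \<in> {1..n}" for j
    proof -
      have "v j = (v j - z) + z"
        using that Suc.prems(2)[of j "Suc n"] by (simp add: z_def diff_add_cancel_ennreal)
      then show ?thesis by (metis distrib_right)
    qed
    then have "(\<Sum>j=1..n. v j * g j) = (\<Sum>j=1..n. (v j - z) * g j + z * g j)"
      by (intro sum.cong) auto
    then show ?thesis by (simp add: z_def sum.distrib sum_distrib_left distrib_left add_ac)
  qed
  have "(\<Sum>j=1..n. (v j - z) * a j) \<le> (\<Sum>j=1..n. (v j - z) * b j)"
    using Suc.prems by (intro Suc.IH ennreal_minus_mono) auto
  moreover have "z * sum a {1..Suc n} \<le> z * sum b {1..Suc n}"
    using Suc.prems(1)[of "Suc n"] by (intro mult_left_mono) auto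
  ultimately show ?case unfolding Abel by (rule add_mono)
qed simp

lemma sum_power2_eq_offdiag:
  fixes z :: "'b \<Rightarrow> 'c :: comm_semiring_1"
  assumes "finite B"
  shows "(sum z B)\<^sup>2 = (\<Sum>j\<in>B. (z j)\<^sup>2) + (\<Sum>i\<in>B. \<Sum>k\<in>B - {i}. z i * z k)"
proof -
  have "(sum z B)\<^sup>2 = (\<Sum>i\<in>B. \<Sum>k\<in>B. z i * z k)" by (simp add: power2_eq_square sum_product)
  also have "\<dots> = (\<Sum>i\<in>B. (z i)\<^sup>2 + (\<Sum>k\<in>B - {i}. z i * z k))"
    using assms by (intro sum.cong refl) (simp add: sum.remove power2_eq_square)
  finally show ?thesis by (simp add: sum.distrib)
qed

subsection \<open>Work done in the preemptive schedule\<close>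

definition sp_busy :: "(nat \<Rightarrow> real) \<Rightarrow> (nat \<Rightarrow> real) \<Rightarrow> nat \<Rightarrow> real set" where
  "sp_busy r q j = {t. sp_pending r q j t \<and> (\<forall>k\<in>{1..<j}. \<not> sp_pending r q k t)}"

definition sp_work :: "(nat \<Rightarrow> real) \<Rightarrow> (nat \<Rightarrow> real) \<Rightarrow> nat \<Rightarrow> real \<Rightarrow> real" where
  "sp_work r q j t = (LBINT s:{0..t}. sp_ind r q j s)"

lemma sp_ind_eq_indicator: "sp_ind r q j = indicator (sp_busy r q j)"
  by (auto simp: sp_ind_def sp_busy_def fun_eq_iff)

lemma sp_busy_sets [measurable]: "sp_busy r q j \<in> sets borel"
proof -
  have "sp_busy r q j = {t. sp_pending r q j t} - (\<Union>k\<in>{1..<j}. {s. sp_pending r q k s})"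
    by (auto simp: sp_busy_def)
  then show ?thesis using sets_sp_pending by (auto intro!: sets.Diff sets.finite_UN)
qed

lemma fmeasurable_sp_busy_Int: "A \<in> fmeasurable lborel \<Longrightarrow> sp_busy r q j \<inter> A \<in> fmeasurable lborel"
  by (subst Int_commute) (simp add: fmeasurable_Int_fmeasurable)

lemma sp_busy_disjoint:
  assumes "i \<noteq> j" "1 \<le> i" "1 \<le> j"
  shows "sp_busy r q i \<inter> sp_busy r q j = {}"
  using assms by (cases "i < j") (auto simp: sp_busy_def)

lemma UN_sp_busy: "(\<Union>k\<in>{1..i}. sp_busy r q k) = {t. \<exists>k\<in>{1..i}. sp_pending r q k t}"
proof (intro equalityI subsetI)
  fix t assume "t \<in> {t. \<exists>k\<in>{1..i}. sp_pending r q k t}"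
  then obtain k where k: "k \<in> {1..i} \<and> sp_pending r q k t"
    and "\<And>m. m < k \<Longrightarrow> \<not> (m \<in> {1..i} \<and> sp_pending r q m t)"
    using exists_least_iff[of "\<lambda>k. k \<in> {1..i} \<and> sp_pending r q k t"] by auto
  then have "t \<in> sp_busy r q k" by (auto simp: sp_busy_def)
  then show "t \<in> (\<Union>k\<in>{1..i}. sp_busy r q k)" using k by blast
qed (auto simp: sp_busy_def)

lemma sp_work_eq_measure: "sp_work r q j t = measure lborel (sp_busy r q j \<inter> {0..t})"
proof -
  have "sp_work r q j t = (LBINT s. indicator (sp_busy r q j \<inter> {0..t}) s)"
    unfolding sp_work_def set_lebesgue_integral_def sp_ind_eq_indicator
    by (intro Bochner_Integration.integral_cong) (auto simp: indicator_def)
  then show ?thesis by simp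
qed

lemma sp_work_nonneg: "0 \<le> sp_work r q j t"
  by (simp add: sp_work_eq_measure)

lemma sp_work_nonpos:
  assumes "t \<le> 0"
  shows "sp_work r q j t = 0"
proof -
  have "measure lborel (sp_busy r q j \<inter> {0..t}) \<le> measure lborel {0::real}"
    using assms by (intro measure_mono_fmeasurable) (auto intro!: fmeasurableI)
  then show ?thesis by (simp add: sp_work_eq_measure measure_le_0_iff)
qed

lemma sp_work_diff:
  assumes "0 \<le> a" "a \<le> b"
  shows "sp_work r q j b - sp_work r q j a = measure lborel (sp_busy r q j \<inter> {a<..b})"
proof -
  have "sp_busy r q j \<inter> {0..b} = (sp_busy r q j \<inter> {0..a}) \<union> (sp_busy r q j \<inter> {a<..b})"
    using assms by auto
  moreover have "measure lborel ((sp_busy r q j \<inter> {0..a}) \<union> (sp_busy r q j \<inter> {a<..b})) =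
      measure lborel (sp_busy r q j \<inter> {0..a}) + measure lborel (sp_busy r q j \<inter> {a<..b})"
    by (intro measure_Un_AE fmeasurable_sp_busy_Int fmeasurable_Ioc fmeasurable_compact) auto
  ultimately show ?thesis by (simp add: sp_work_eq_measure)
qed

lemma sum_sp_work_diff:
  assumes "0 \<le> a" "a \<le> b" "finite K" "\<And>k. k \<in> K \<Longrightarrow> 1 \<le> k"
  shows "(\<Sum>k\<in>K. sp_work r q k b - sp_work r q k a)
           = measure lborel ((\<Union>k\<in>K. sp_busy r q k) \<inter> {a<..b})"
proof -
  have "disjoint_family_on (\<lambda>k. sp_busy r q k \<inter> {a<..b}) K"
    unfolding disjoint_family_on_def using sp_busy_disjoint assms(4) by blast
  then have "measure lborel (\<Union>k\<in>K. sp_busy r q k \<inter> {a<..b})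
      = (\<Sum>k\<in>K. measure lborel (sp_busy r q k \<inter> {a<..b}))"
    using assms(3) fmeasurable_sp_busy_Int[OF fmeasurable_Ioc, of r q _ a b]
    by (intro measure_finite_Union) (auto simp: fmeasurable_def less_top[symmetric])
  then show ?thesis using assms(1,2) by (simp add: sp_work_diff)
qed

lemma sum_sp_work_diff_le:
  assumes "0 \<le> a" "a \<le> b" "finite K" "\<And>k. k \<in> K \<Longrightarrow> 1 \<le> k"
  shows "(\<Sum>k\<in>K. sp_work r q k b - sp_work r q k a) \<le> b - a"
proof -
  have "measure lborel ((\<Union>k\<in>K. sp_busy r q k) \<inter> {a<..b}) \<le> measure lborel {a<..b}"
    using assms(3) by (intro measure_mono_fmeasurable) auto
  then show ?thesis using sum_sp_work_diff[OF assms] assms(2) by simp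
qed

lemma sum_sp_work_diff_eq:
  assumes "0 \<le> a" "a \<le> b" "\<And>t. a \<le> t \<Longrightarrow> t < b \<Longrightarrow> \<exists>k\<in>{1..i}. sp_pending r q k t"
  shows "(\<Sum>k=1..i. sp_work r q k b - sp_work r q k a) = b - a"
proof -
  have "measure lborel {a<..<b} \<le> measure lborel ((\<Union>k\<in>{1..i}. sp_busy r q k) \<inter> {a<..b})"
  proof (rule measure_mono_fmeasurable)
    show "{a<..<b} \<subseteq> (\<Union>k\<in>{1..i}. sp_busy r q k) \<inter> {a<..b}"
      unfolding UN_sp_busy using assms(3) by auto
    show "(\<Union>k\<in>{1..i}. sp_busy r q k) \<inter> {a<..b} \<in> fmeasurable lborel"
      by (subst Int_commute, rule fmeasurable_Int_fmeasurable) auto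
  qed simp
  then show ?thesis
    using sum_sp_work_diff[of a b "{1..i}" r q] sum_sp_work_diff_le[of a b "{1..i}" r q] assms
    by simp
qed

lemma sp_work_mono:
  assumes "0 \<le> a" "a \<le> b"
  shows "sp_work r q j a \<le> sp_work r q j b"
  using sp_work_diff[OF assms, of r q j] measure_nonneg[of lborel] by (smt (verit))

lemma mono_sp_work: "mono (sp_work r q j)"
  by (rule monoI) (metis sp_work_mono sp_work_nonneg sp_work_nonpos linear)

lemma sp_work_measurable [measurable]: "sp_work r q j \<in> borel_measurable borel"
  by (rule borel_measurable_mono[OF mono_sp_work])

lemma sp_work_lipschitz:
  assumes "0 \<le> a" "a \<le> b"
  shows "sp_work r q j b - sp_work r q j a \<le> b - a"
proof -
  have "measure lborel (sp_busy r q j \<inter> {a<..b}) \<le> measure lborel {a<..b}"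
    by (intro measure_mono_fmeasurable) auto
  then show ?thesis using sp_work_diff[OF assms] assms(2) by simp
qed

lemma continuous_on_sp_work:
  assumes "S \<subseteq> {0..}"
  shows "continuous_on S (sp_work r q j)"
proof (rule lipschitz_on_continuous_on[where L=1], rule lipschitz_onI)
  fix a b :: real assume "a \<in> S" "b \<in> S"
  then have "0 \<le> a" "0 \<le> b" using assms by auto
  then show "dist (sp_work r q j a) (sp_work r q j b) \<le> 1 * dist a b"
    using sp_work_lipschitz[of a b r q j] sp_work_lipschitz[of b a r q j]
      sp_work_mono[of a b r q j] sp_work_mono[of b a r q j]
    by (cases "a \<le> b") (auto simp: dist_real_def abs_real_def)
qed simp

lemma sp_work_const:
  assumes "0 \<le> a" "a \<le> b" "\<And>t. a \<le> t \<Longrightarrow> t < b \<Longrightarrow> t \<notin> sp_busy r q j"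
  shows "sp_work r q j b = sp_work r q j a"
proof -
  have "measure lborel (sp_busy r q j \<inter> {a<..b}) \<le> measure lborel {b}"
  proof (rule measure_mono_fmeasurable)
    show "sp_busy r q j \<inter> {a<..b} \<subseteq> {b}"
      using assms(3) by (metis IntE greaterThanAtMost_iff insertI1 less_eq_real_def subsetI)
  qed (auto intro!: fmeasurableI)
  then show ?thesis using sp_work_diff[OF assms(1,2), of r q j] by (simp add: measure_le_0_iff)
qed

locale preemptive_schedule =
  fixes n :: nat and r q :: "nat \<Rightarrow> real"
  assumes release_nonneg: "j \<in> {1..n} \<Longrightarrow> 0 \<le> r j"
    and q_pos: "j \<in> {1..n} \<Longrightarrow> 0 < q j"
begin

abbreviation "pending \<equiv> sp_pending r q"
abbreviation "busy \<equiv> sp_busy r q"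
abbreviation "work \<equiv> sp_work r q"
abbreviation "apoint \<equiv> alpha_point r q"
abbreviation "mean_busy \<equiv> sp_mean_busy_time r q"

lemma pending_iff: "j \<in> {1..n} \<Longrightarrow> pending j t \<longleftrightarrow> r j \<le> t \<and> work j t < q j"
  unfolding sp_work_def by (intro sp_pending_iff release_nonneg q_pos)

lemma work_before_release:
  assumes "j \<in> {1..n}" "t \<le> r j"
  shows "work j t = 0"
proof (cases "0 \<le> t")
  case True
  then have "work j t = work j 0"
    using assms by (intro sp_work_const) (auto simp: sp_busy_def pending_iff)
  then show ?thesis by (simp add: sp_work_nonpos)
qed (simp add: sp_work_nonpos)

lemma work_le:
  assumes j: "j \<in> {1..n}"
  shows "work j t \<le> q j"
proof (rule ccontr)
  assume gt: "\<not> work j t \<le> q j"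
  then have "0 \<le> t" using q_pos[OF j] sp_work_nonpos[of t r q j] by linarith
  then obtain s where s: "0 \<le> s" "s \<le> t" "work j s = q j"
    using IVT'[of "work j" 0 "q j" t] continuous_on_sp_work[of "{0..t}" r q j]
      gt q_pos[OF j] sp_work_nonpos[of 0 r q j] by force
  have "work j t = work j s"
    using s sp_work_mono[of s _ r q j] j
    by (intro sp_work_const) (auto simp: sp_busy_def pending_iff not_less)
  then show False using gt s by simp
qed

lemma pending_persists:
  assumes "j \<in> {1..n}" "r j \<le> s" "s \<le> t" "work j t < q j"
  shows "pending j s"
  using assms sp_work_mono[of s t r q j] release_nonneg[of j] by (auto simp: pending_iff)

lemma work_completes:
  assumes j: "j \<in> {1..n}"
  shows "\<exists>t\<ge>r j. work j t = q j"
proof (rule ccontr)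
  assume never: "\<not> (\<exists>t\<ge>r j. work j t = q j)"
  define T where "T = r j + (\<Sum>k=1..n. q k) + 1"
  have T: "r j \<le> T" "0 \<le> r j"
    using release_nonneg[OF j] sum_nonneg[of "{1..n}" q] q_pos[THEN less_imp_le]
    by (auto simp: T_def)
  then have "work j T < q j" using work_le[OF j, of T] never by force
  then have "(\<Sum>k=1..n. work k T - work k (r j)) = T - r j"
    using T j
    by (intro sum_sp_work_diff_eq) (auto intro!: bexI[of _ j] intro: pending_persists[of j _ T])
  moreover have "(\<Sum>k=1..n. work k T - work k (r j)) \<le> (\<Sum>k=1..n. q k)"
    by (intro sum_mono) (metis diff_mono diff_zero work_le sp_work_nonneg)
  ultimately show False by (simp add: T_def)
qed

subsection \<open>Points of partial completion\<close>

lemma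
  assumes j: "j \<in> {1..n}" and \<alpha>: "0 \<le> \<alpha>" "\<alpha> \<le> 1"
  shows apoint_nonneg: "0 \<le> apoint j \<alpha>"
    and work_apoint: "work j (apoint j \<alpha>) = \<alpha> * q j"
    and apoint_le_iff: "0 \<le> t \<Longrightarrow> apoint j \<alpha> \<le> t \<longleftrightarrow> \<alpha> * q j \<le> work j t"
proof -
  define S where "S = {0..} \<inter> work j -` {\<alpha> * q j..}"
  have S_iff: "t \<in> S \<longleftrightarrow> 0 \<le> t \<and> \<alpha> * q j \<le> work j t" for t by (auto simp: S_def)
  have target: "0 \<le> \<alpha> * q j" "\<alpha> * q j \<le> q j" using \<alpha> q_pos[OF j] by auto
  obtain T where T: "T \<ge> r j" "work j T = q j" using work_completes[OF j] by blast
  then have "T \<in> S" using target release_nonneg[OF j] by (simp add: S_iff)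
  moreover have "closed S"
    unfolding S_def by (intro continuous_closed_preimage continuous_on_sp_work) auto
  moreover have "bdd_below S" by (auto simp: S_iff intro!: bdd_belowI[of _ 0])
  ultimately have Inf: "Inf S \<in> S" "\<And>t. t \<in> S \<Longrightarrow> Inf S \<le> t"
    using closed_contains_Inf[of S] by (auto intro: cInf_lower)
  have eq: "apoint j \<alpha> = Inf S"
    unfolding alpha_point_def sp_work_def[symmetric]
    by (rule Least_equality) (use Inf in \<open>auto simp: S_iff\<close>)
  show "0 \<le> apoint j \<alpha>" using Inf(1) by (simp add: eq S_iff)
  show iff: "apoint j \<alpha> \<le> t \<longleftrightarrow> \<alpha> * q j \<le> work j t" if "0 \<le> t" for t
    using Inf that sp_work_mono[of "Inf S" t r q j] by (force simp: eq S_iff)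
  obtain t where t: "0 \<le> t" "t \<le> Inf S" "work j t = \<alpha> * q j"
    using IVT'[of "work j" 0 "\<alpha> * q j" "Inf S"] continuous_on_sp_work[of "{0..Inf S}" r q j]
      Inf(1) target sp_work_nonpos[of 0 r q j] by (force simp: S_iff)
  then have "Inf S = t" using Inf(2)[of t] by (simp add: S_iff)
  then show "work j (apoint j \<alpha>) = \<alpha> * q j" using t by (simp add: eq)
qed

lemma apoint_mono:
  assumes "j \<in> {1..n}" "0 \<le> \<alpha>" "\<alpha> \<le> \<beta>" "\<beta> \<le> 1"
  shows "apoint j \<alpha> \<le> apoint j \<beta>"
  using assms apoint_nonneg[of j \<beta>] work_apoint[of j \<beta>] q_pos[of j]
  by (subst apoint_le_iff) (auto intro: mult_right_mono)

text \<open>Outside the unit interval the \<open>\<alpha>\<close>-point is a junk value: \<open>0\<close> to the left,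
  and an unspecified constant to the right.\<close>

lemma apoint_measurable [measurable]:
  assumes j: "j \<in> {1..n}"
  shows "apoint j \<in> borel_measurable borel"
proof (rule borel_measurable_piecewise_mono[where C="{{..<0}, {0..1}, {1<..}}"])
  have "apoint j \<alpha> = 0" if "\<alpha> < 0" for \<alpha>
    unfolding alpha_point_def sp_work_def[symmetric]
  proof (rule Least_equality)
    have "\<alpha> * q j \<le> 0" using that q_pos[OF j] by (simp add: mult_le_0_iff)
    then show "0 \<le> (0::real) \<and> \<alpha> * q j \<le> work j 0"
      using sp_work_nonneg[of r q j 0] by linarith
  qed simp
  moreover have "apoint j \<alpha> = (LEAST t. False)" if "1 < \<alpha>" for \<alpha>
  proof -
    have "\<not> \<alpha> * q j \<le> work j t" for t
      using that q_pos[OF j] work_le[OF j, of t] mult_strict_right_mono[of 1 \<alpha> "q j"] by linarith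
    then show ?thesis unfolding alpha_point_def sp_work_def[symmetric] by simp
  qed
  ultimately show "mono_on C (apoint j)" if "C \<in> {{..<0}, {0..1}, {1<..}}" for C
    using that apoint_mono[OF j] by (auto intro!: mono_onI)
qed auto

lemma release_less_apoint:
  assumes "j \<in> {1..n}" "0 < \<alpha>" "\<alpha> \<le> 1"
  shows "r j < apoint j \<alpha>"
proof (rule ccontr)
  assume "\<not> r j < apoint j \<alpha>"
  then have "work j (apoint j \<alpha>) = 0" using assms by (intro work_before_release) auto
  then show False using assms work_apoint[of j \<alpha>] q_pos[of j] by auto
qed

lemma pending_iff_less_apoint: "j \<in> {1..n} \<Longrightarrow> pending j t \<longleftrightarrow> r j \<le> t \<and> t < apoint j 1"
  using release_nonneg[of j] apoint_le_iff[of j 1 t] by (auto simp: pending_iff)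

lemma pending_between_apoints:
  assumes "j \<in> {1..n}" "0 < \<alpha>" "\<alpha> \<le> 1" "apoint j \<alpha> \<le> t" "t < apoint j 1"
  shows "pending j t"
  using assms release_less_apoint[of j \<alpha>] by (simp add: pending_iff_less_apoint)

lemma work_apoint_lower_priority:
  assumes "j \<in> {1..n}" "j < k" "0 < \<alpha>" "\<alpha> \<le> 1"
  shows "work k (apoint j \<alpha>) = work k (apoint j 1)"
  using assms apoint_mono[of j \<alpha> 1] apoint_nonneg[of j \<alpha>] pending_between_apoints[of j \<alpha>]
  by (intro sp_work_const[symmetric]) (auto simp: sp_busy_def intro!: bexI[of _ j])

text \<open>A job that has priority over \<open>j\<close> and is released before an \<open>\<alpha>\<close>-point of \<open>j\<close> is
  finished there, since \<open>j\<close> is processed immediately before that point.\<close>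

lemma work_apoint_higher_priority:
  assumes "j \<in> {1..n}" "k \<in> {1..<j}" "0 < \<alpha>" "\<alpha> \<le> 1"
  shows "work k (apoint j \<alpha>) = 0 \<or> work k (apoint j \<alpha>) = q k"
proof (cases "apoint j \<alpha> \<le> r k")
  case True
  then show ?thesis using assms by (intro disjI1 work_before_release) auto
next
  case False
  have k: "k \<in> {1..n}" using assms by auto
  have "\<not> work k (apoint j \<alpha>) < q k"
  proof
    assume unfinished: "work k (apoint j \<alpha>) < q k"
    have "work j (apoint j \<alpha>) = work j (r k)"
      using False assms release_nonneg[OF k] pending_persists[OF k _ _ unfinished]
      by (intro sp_work_const) (auto simp: sp_busy_def intro!: bexI[of _ k])
    then have "apoint j \<alpha> \<le> r k"
      using assms work_apoint[of j \<alpha>] release_nonneg[OF k] by (subst apoint_le_iff) auto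
    then show False using False by simp
  qed
  then show ?thesis using work_le[OF k, of "apoint j \<alpha>"] by simp
qed

definition progress :: "nat \<Rightarrow> nat \<Rightarrow> real \<Rightarrow> real" where
  "progress j k \<alpha> = work k (apoint j \<alpha>) / q k"

lemma progress_measurable [measurable]: "j \<in> {1..n} \<Longrightarrow> progress j k \<in> borel_measurable borel"
  unfolding progress_def by measurable

lemma progress_bounds:
  assumes "k \<in> {1..n}"
  shows "0 \<le> progress j k \<alpha>" and "progress j k \<alpha> \<le> 1"
  using assms q_pos[of k] work_le[of k] sp_work_nonneg[of r q k] by (auto simp: progress_def)

lemma progress_self: "j \<in> {1..n} \<Longrightarrow> \<alpha> \<in> {0<..1} \<Longrightarrow> progress j j \<alpha> = \<alpha>"
  using q_pos[of j] by (simp add: progress_def work_apoint)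

lemma progress_lower_priority:
  assumes "j \<in> {1..n}" "j < k" "\<alpha> \<in> {0<..1}"
  shows "progress j k \<alpha> = progress j k 1"
  using assms work_apoint_lower_priority[of j k \<alpha>] by (simp add: progress_def)

lemma progress_higher_priority:
  assumes "j \<in> {1..n}" "k \<in> {1..<j}" "\<alpha> \<in> {0<..1}"
  shows "progress j k \<alpha> \<in> {0, 1}"
  using assms work_apoint_higher_priority[of j k \<alpha>] q_pos[of k] by (auto simp: progress_def)

lemma progress_mono:
  assumes "j \<in> {1..n}" "k \<in> {1..n}" "0 < \<alpha>" "\<alpha> \<le> \<beta>" "\<beta> \<le> 1"
  shows "progress j k \<alpha> \<le> progress j k \<beta>"
  unfolding progress_def
  using assms q_pos[of k] apoint_nonneg[of j \<alpha>] apoint_mono[of j \<alpha> \<beta>]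
  by (intro divide_right_mono sp_work_mono) auto

definition idle_before :: "nat \<Rightarrow> real" where
  "idle_before j = apoint j 1 - (\<Sum>k=1..n. work k (apoint j 1))"

lemma idle_before_nonneg: "j \<in> {1..n} \<Longrightarrow> 0 \<le> idle_before j"
  using sum_sp_work_diff_le[of 0 "apoint j 1" "{1..n}" r q] apoint_nonneg[of j 1]
  by (auto simp: idle_before_def sp_work_nonpos)

text \<open>The machine does not idle between two \<open>\<alpha>\<close>-points of \<open>j\<close>, so the idle time does not
  depend on \<open>\<alpha>\<close>.\<close>

lemma apoint_eq_idle_plus_progress:
  assumes j: "j \<in> {1..n}" and \<alpha>: "\<alpha> \<in> {0<..1}"
  shows "apoint j \<alpha> = idle_before j + \<alpha> * q j + (\<Sum>k\<in>{1..n} - {j}. q k * progress j k \<alpha>)"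
proof -
  have "(\<Sum>k=1..n. work k (apoint j 1) - work k (apoint j \<alpha>)) = apoint j 1 - apoint j \<alpha>"
    using assms apoint_mono[of j \<alpha> 1] apoint_nonneg[of j \<alpha>] pending_between_apoints[of j \<alpha>]
    by (intro sum_sp_work_diff_eq) (auto intro!: bexI[of _ j])
  then have "apoint j \<alpha> = idle_before j + (\<Sum>k=1..n. work k (apoint j \<alpha>))"
    by (simp add: idle_before_def sum_subtractf)
  moreover have "work k (apoint j \<alpha>) = q k * progress j k \<alpha>" if "k \<in> {1..n}" for k
    using q_pos[OF that] by (simp add: progress_def)
  ultimately show ?thesis using j \<alpha> by (simp add: sum.remove[of _ j] progress_self)
qed

subsection \<open>Mean busy times\<close>

lemma busy_subset: "j \<in> {1..n} \<Longrightarrow> busy j \<subseteq> {r j..<apoint j 1}"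
  by (auto simp: sp_busy_def pending_iff_less_apoint)

lemma emeasure_busy_after:
  assumes j: "j \<in> {1..n}" and "0 \<le> s"
  shows "emeasure lborel (busy j \<inter> {s<..}) = ennreal (q j - work j s)"
proof -
  define T where "T = max s (apoint j 1)"
  have "work j T \<ge> q j"
    using j sp_work_mono[of "apoint j 1" T r q j] apoint_nonneg[of j 1] work_apoint[of j 1]
    by (auto simp: T_def)
  then have "work j T = q j" using work_le[OF j, of T] by simp
  moreover have "busy j \<inter> {s<..} = busy j \<inter> {s<..T}"
    using busy_subset[OF j] by (auto simp: T_def)
  ultimately show ?thesis
    using sp_work_diff[of s T r q j] \<open>0 \<le> s\<close>
      fmeasurable_sp_busy_Int[OF fmeasurable_Ioc, of r q j s T]
    by (simp add: T_def emeasure_eq_measure2)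
qed

lemma
  assumes j: "j \<in> {1..n}"
  shows mean_busy_nonneg: "0 \<le> mean_busy j"
    and nn_integral_busy: "(\<integral>\<^sup>+t\<in>busy j. ennreal t \<partial>lborel) = ennreal (q j * mean_busy j)"
proof -
  have range: "0 \<le> t \<and> t \<le> apoint j 1" if "t \<in> busy j" for t
    using that busy_subset[OF j] release_nonneg[OF j] by force
  have "(LBINT t:{0..}. sp_ind r q j t * t) = (LBINT t. t * indicator (busy j) t)"
    unfolding set_lebesgue_integral_def sp_ind_eq_indicator
    using range by (intro Bochner_Integration.integral_cong) (auto simp: indicator_def)
  then have mean_busy: "q j * mean_busy j = (LBINT t. t * indicator (busy j) t)"
    using q_pos[OF j] by (simp add: sp_mean_busy_time_def)
  then have "0 \<le> q j * mean_busy j"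
    using range by (auto intro!: Bochner_Integration.integral_nonneg simp: indicator_def)
  then show "0 \<le> mean_busy j" using q_pos[OF j] by (simp add: zero_le_mult_iff)
  have "integrable lborel (\<lambda>t. t * indicator (busy j) t)"
  proof (rule integrableI_bounded_set[where A="{0..apoint j 1}" and B="apoint j 1"])
    show "emeasure lborel {0..apoint j 1} < \<infinity>" by (simp add: emeasure_lborel_Icc_eq)
  qed (use range in \<open>auto simp: indicator_def\<close>)
  then show "(\<integral>\<^sup>+t\<in>busy j. ennreal t \<partial>lborel) = ennreal (q j * mean_busy j)"
    unfolding mean_busy nn_integral_set_ennreal
    using range by (intro nn_integral_eq_integral) (auto simp: indicator_def)
qed

lemma nn_integral_apoint:
  assumes j: "j \<in> {1..n}"
  shows "(\<integral>\<^sup>+\<alpha>\<in>{0<..1}. ennreal (apoint j \<alpha>) \<partial>lborel)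
    = (\<integral>\<^sup>+s\<in>{0..}. ennreal (1 - work j s / q j) \<partial>lborel)"
proof -
  note [measurable] = apoint_measurable[OF j]
  note q = q_pos[OF j]
  have "(\<integral>\<^sup>+\<alpha>\<in>{0<..1}. ennreal (apoint j \<alpha>) \<partial>lborel)
      = (\<integral>\<^sup>+s\<in>{0..}. emeasure lborel ({0<..1} \<inter> {\<alpha> \<in> space lborel. s < apoint j \<alpha>}) \<partial>lborel)"
    by (rule lborel.set_nn_integral_layer_cake) measurable
  also have "\<dots> = (\<integral>\<^sup>+s\<in>{0..}. ennreal (1 - work j s / q j) \<partial>lborel)"
  proof (rule set_nn_integral_cong)
    fix s :: real assume s: "s \<in> space lborel \<inter> {0..}"
    have fraction: "0 \<le> work j s / q j" "work j s / q j \<le> 1"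
      using q work_le[OF j, of s] sp_work_nonneg[of r q j s] by auto
    have "s < apoint j \<alpha> \<longleftrightarrow> work j s / q j < \<alpha>" if "\<alpha> \<in> {0<..1}" for \<alpha>
      using that s apoint_le_iff[OF j, of \<alpha> s]
      by (simp add: pos_le_divide_eq[OF q] linorder_not_le[symmetric])
    then have "{0<..1} \<inter> {\<alpha>. s < apoint j \<alpha>} = {work j s / q j<..1}"
      using fraction(1) by (auto intro: order.strict_trans1)
    then show "emeasure lborel ({0<..1} \<inter> {\<alpha> \<in> space lborel. s < apoint j \<alpha>})
        = ennreal (1 - work j s / q j)"
      using fraction(2) by simp
  qed simp_all
  finally show ?thesis .
qed

lemma mean_busy_eq_average_apoint:
  assumes j: "j \<in> {1..n}"
  shows "mean_busy j = (LBINT \<alpha>:{0<..1}. apoint j \<alpha>)"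
proof -
  note [measurable] = apoint_measurable[OF j]
  note q = q_pos[OF j]
  have bounds: "0 \<le> apoint j \<alpha> \<and> apoint j \<alpha> \<le> apoint j 1" if "\<alpha> \<in> {0<..1}" for \<alpha>
    using that apoint_nonneg[OF j, of \<alpha>] apoint_mono[OF j, of \<alpha> 1] by auto
  have "integrable lborel (\<lambda>\<alpha>. indicator {0<..1} \<alpha> *\<^sub>R apoint j \<alpha>)"
    using bounds by (intro integrableI_bounded_set_indicator[where B="apoint j 1"]) auto
  then have average: "ennreal (LBINT \<alpha>:{0<..1}. apoint j \<alpha>)
      = (\<integral>\<^sup>+\<alpha>\<in>{0<..1}. ennreal (apoint j \<alpha>) \<partial>lborel)"
    unfolding set_lebesgue_integral_def nn_integral_set_ennreal
    using bounds
    by (subst nn_integral_eq_integral[symmetric]) (auto simp: indicator_def mult.commute)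
  have average_nonneg: "0 \<le> (LBINT \<alpha>:{0<..1}. apoint j \<alpha>)"
    unfolding set_lebesgue_integral_def using bounds
    by (auto intro!: Bochner_Integration.integral_nonneg simp: indicator_def)
  have "ennreal (q j * mean_busy j) = (\<integral>\<^sup>+s\<in>{0..}. emeasure lborel (busy j \<inter> {s<..}) \<partial>lborel)"
    unfolding nn_integral_busy[OF j, symmetric]
    by (subst lborel.set_nn_integral_layer_cake) (auto simp: greaterThan_def)
  also have "\<dots> = (\<integral>\<^sup>+s\<in>{0..}. ennreal (q j) * ennreal (1 - work j s / q j) \<partial>lborel)"
    using emeasure_busy_after[OF j] q
    by (intro set_nn_integral_cong) (auto simp: right_diff_distrib simp flip: ennreal_mult')
  also have "\<dots> = ennreal (q j) * (\<integral>\<^sup>+s\<in>{0..}. ennreal (1 - work j s / q j) \<partial>lborel)"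
    by (simp add: nn_integral_cmult mult.assoc)
  also have "\<dots> = ennreal (q j * (LBINT \<alpha>:{0<..1}. apoint j \<alpha>))"
    using q by (simp only: nn_integral_apoint[OF j] average ennreal_mult')
  finally show ?thesis using q mean_busy_nonneg[OF j] average_nonneg by simp
qed

subsection \<open>The mean busy time relaxation\<close>

definition mbt_feasible :: "(nat \<Rightarrow> ennreal) \<Rightarrow> bool" where
  "mbt_feasible m \<longleftrightarrow> (\<forall>B\<subseteq>{1..n}. \<forall>l\<ge>0. (\<forall>j\<in>B. l \<le> r j) \<longrightarrow>
     ennreal (l * sum q B + (sum q B)\<^sup>2 / 2) \<le> (\<Sum>j\<in>B. ennreal (q j) * m j))"

text \<open>The busy periods of the first \<open>i\<close> jobs start at those release dates at which all jobs
  released earlier are finished.\<close>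

definition cleared :: "nat \<Rightarrow> real \<Rightarrow> bool" where
  "cleared i t \<longleftrightarrow> (\<forall>k\<in>{1..i}. r k < t \<longrightarrow> apoint k 1 \<le> t)"

definition period_starts :: "nat \<Rightarrow> real set" where
  "period_starts i = {r k |k. k \<in> {1..i} \<and> cleared i (r k)}"

definition period_start :: "nat \<Rightarrow> real \<Rightarrow> real" where
  "period_start i t = Max {l \<in> period_starts i. l \<le> t}"

definition period_jobs :: "nat \<Rightarrow> real \<Rightarrow> nat set" where
  "period_jobs i l = {k \<in> {1..i}. period_start i (r k) = l}"

lemma finite_period_starts: "finite (period_starts i)"
proof -
  have "period_starts i \<subseteq> r ` {1..i}" by (auto simp: period_starts_def)
  then show ?thesis by (rule finite_subset) simp
qed

lemma ex_cleared_release: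
  assumes "i \<le> n" "k \<in> {1..i}" "s < r k" and idle: "\<And>m. m \<in> {1..i} \<Longrightarrow> \<not> pending m s"
  shows "\<exists>l\<in>period_starts i. s < l \<and> l \<le> r k"
proof -
  define R where "R = r ` {m \<in> {1..i}. s < r m}"
  have R: "finite R" "r k \<in> R" using assms(2,3) by (auto simp: R_def)
  then have "Min R \<in> R" by (intro Min_in) auto
  then obtain j where j: "j \<in> {1..i}" "s < r j" "Min R = r j" by (auto simp: R_def)
  have "cleared i (r j)"
    unfolding cleared_def
  proof (intro ballI impI)
    fix m assume m: "m \<in> {1..i}" "r m < r j"
    then have "r m \<notin> R" using Min_le[OF R(1), of "r m"] j(3) by auto
    then have "r m \<le> s" using m(1) by (auto simp: R_def)
    then have "apoint m 1 \<le> s"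
      using idle[OF m(1)] m(1) \<open>i \<le> n\<close> by (auto simp: pending_iff_less_apoint)
    then show "apoint m 1 \<le> r j" using j(2) by simp
  qed
  then have "r j \<in> period_starts i" using j(1) by (auto simp: period_starts_def)
  then show ?thesis using j Min_le[OF R] by auto
qed

lemma period_start_props:
  assumes "i \<le> n" "k \<in> {1..i}" "r k \<le> t"
  shows period_start_in: "period_start i t \<in> period_starts i"
    and period_start_le: "period_start i t \<le> t"
    and period_start_ge: "l \<in> period_starts i \<Longrightarrow> l \<le> t \<Longrightarrow> l \<le> period_start i t"
proof -
  have release: "0 \<le> r m" if "m \<in> {1..i}" for m using that \<open>i \<le> n\<close> release_nonneg[of m] by auto
  have "\<exists>l\<in>period_starts i. -1 < l \<and> l \<le> r k"
    using assms release by (intro ex_cleared_release) (force simp: pending_iff_less_apoint)+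
  then have "{l \<in> period_starts i. l \<le> t} \<noteq> {}" using assms(3) by force
  then have "period_start i t \<in> {l \<in> period_starts i. l \<le> t}"
    unfolding period_start_def using finite_period_starts by (intro Max_in) auto
  then show "period_start i t \<in> period_starts i" "period_start i t \<le> t" by auto
  show "l \<le> period_start i t" if "l \<in> period_starts i" "l \<le> t"
    unfolding period_start_def using that finite_period_starts by (intro Max_ge) auto
qed

lemma pending_since_period_start:
  assumes "i \<le> n" "k \<in> {1..i}" "pending k t" "period_start i t \<le> s" "s \<le> t"
  shows "\<exists>m\<in>{1..i}. pending m s"
proof (rule ccontr)
  assume idle: "\<not> (\<exists>m\<in>{1..i}. pending m s)"
  have k: "r k \<le> t" "t < apoint k 1" using assms by (auto simp: pending_iff_less_apoint)
  have "s < r k" using idle assms k by (force simp: pending_iff_less_apoint)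
  then obtain l where "l \<in> period_starts i" "s < l" "l \<le> r k"
    using ex_cleared_release[OF assms(1,2)] idle by blast
  then show False using period_start_ge[OF assms(1,2) k(1), of l] k assms(4) by auto
qed

lemma pending_le_period_end:
  assumes "i \<le> n" "k \<in> {1..i}" "pending k t"
  shows "t \<le> period_start i t + sum q (period_jobs i (period_start i t))"
proof -
  define l where "l = period_start i t"
  have n: "m \<in> {1..n}" if "m \<in> {1..i}" for m using that \<open>i \<le> n\<close> by auto
  have "r k \<le> t" using assms n by (simp add: pending_iff_less_apoint)
  note start = period_start_props[OF assms(1,2) this, folded l_def]
  have l: "0 \<le> l" "cleared i l" using start(1) release_nonneg n by (auto simp: period_starts_def)
  have "t - l = (\<Sum>m=1..i. work m t - work m l)"
    using l(1) start(2) pending_since_period_start[OF assms]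
    by (intro sum_sp_work_diff_eq[symmetric]) (auto simp: l_def)
  also have "\<dots> \<le> (\<Sum>m=1..i. if m \<in> period_jobs i l then q m else 0)"
  proof (rule sum_mono)
    fix m assume m: "m \<in> {1..i}"
    note bounds = sp_work_nonneg[of r q m l] work_le[OF n[OF m], of t]
    consider "r m < l" | "l \<le> r m" "r m \<le> t" | "t < r m" by linarith
    then show "work m t - work m l \<le> (if m \<in> period_jobs i l then q m else 0)"
    proof cases
      case 1
      then have "q m \<le> work m l"
        using l m n[OF m] apoint_le_iff[of m 1 l] by (auto simp: cleared_def)
      then show ?thesis using bounds q_pos[OF n[OF m]] by auto
    next
      case 2
      note start_m = period_start_props[OF assms(1) m order_refl]
      have "period_start i (r m) = l"
        using 2 start(1) start(3)[of "period_start i (r m)"] start_m by (intro antisym) auto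
      then show ?thesis using bounds m by (simp add: period_jobs_def)
    next
      case 3
      then show ?thesis
        using bounds work_before_release[OF n[OF m], of t] q_pos[OF n[OF m]] by auto
    qed
  qed
  also have "\<dots> = sum q (period_jobs i l)"
    by (simp add: sum.inter_filter[symmetric] period_jobs_def)
  finally show ?thesis by (simp add: l_def)
qed

lemma UN_busy_subset_periods:
  assumes "i \<le> n"
  shows "(\<Union>k\<in>{1..i}. busy k) \<subseteq> (\<Union>l\<in>period_starts i. {l..l + sum q (period_jobs i l)})"
proof
  fix t assume "t \<in> (\<Union>k\<in>{1..i}. busy k)"
  then obtain k where k: "k \<in> {1..i}" "pending k t" unfolding UN_sp_busy by blast
  then have "r k \<le> t" using assms by (simp add: pending_iff_less_apoint)
  then show "t \<in> (\<Union>l\<in>period_starts i. {l..l + sum q (period_jobs i l)})"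
    using period_start_props[OF assms k(1)] pending_le_period_end[OF assms k]
    by (intro UN_I[of "period_start i t"]) auto
qed

lemma nn_integral_UN_busy:
  assumes "i \<le> n"
  shows "(\<integral>\<^sup>+t\<in>(\<Union>k\<in>{1..i}. busy k). ennreal t \<partial>lborel) = (\<Sum>j=1..i. ennreal (q j * mean_busy j))"
proof -
  have "disjoint_family_on busy {1..i}"
    unfolding disjoint_family_on_def using sp_busy_disjoint by auto
  then have "indicator (\<Union>k\<in>{1..i}. busy k) t = (\<Sum>k=1..i. indicator (busy k) t :: ennreal)" for t
    by (intro indicator_UN_disjoint) auto
  then have "(\<integral>\<^sup>+t\<in>(\<Union>k\<in>{1..i}. busy k). ennreal t \<partial>lborel)
      = (\<integral>\<^sup>+t. (\<Sum>k=1..i. ennreal t * indicator (busy k) t) \<partial>lborel)"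
    by (simp add: sum_distrib_left)
  also have "\<dots> = (\<Sum>k=1..i. \<integral>\<^sup>+t\<in>busy k. ennreal t \<partial>lborel)"
    by (rule nn_integral_sum) measurable
  also have "\<dots> = (\<Sum>j=1..i. ennreal (q j * mean_busy j))"
    using assms by (intro sum.cong refl nn_integral_busy) auto
  finally show ?thesis .
qed

lemma sum_mean_busy_le_periods:
  assumes "i \<le> n"
  shows "(\<Sum>j=1..i. ennreal (q j * mean_busy j)) \<le> (\<Sum>l\<in>period_starts i.
    ennreal (l * sum q (period_jobs i l) + (sum q (period_jobs i l))\<^sup>2 / 2))"
proof -
  define Q where "Q l = sum q (period_jobs i l)" for l
  define U where "U = (\<Union>k\<in>{1..i}. busy k)"
  have "(\<Sum>j=1..i. ennreal (q j * mean_busy j)) = (\<integral>\<^sup>+t\<in>U. ennreal t \<partial>lborel)"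
    unfolding U_def by (rule nn_integral_UN_busy[OF assms, symmetric])
  also have "\<dots> \<le> (\<integral>\<^sup>+t. (\<Sum>l\<in>period_starts i. ennreal t * indicator {l..l + Q l} t) \<partial>lborel)"
  proof (intro nn_integral_mono)
    fix t :: real
    show "ennreal t * indicator U t \<le> (\<Sum>l\<in>period_starts i. ennreal t * indicator {l..l + Q l} t)"
    proof (cases "t \<in> U")
      case True
      then obtain l where l: "l \<in> period_starts i" "t \<in> {l..l + Q l}"
        using UN_busy_subset_periods[OF assms] by (auto simp: U_def Q_def)
      then have "ennreal t * indicator U t = ennreal t * indicator {l..l + Q l} t"
        using True by simp
      also have "\<dots> \<le> (\<Sum>l\<in>period_starts i. ennreal t * indicator {l..l + Q l} t)"
        by (rule member_le_sum) (use l finite_period_starts in auto)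
      finally show ?thesis .
    qed simp
  qed
  also have "\<dots> = (\<Sum>l\<in>period_starts i. \<integral>\<^sup>+t\<in>{l..l + Q l}. ennreal t \<partial>lborel)"
    by (rule nn_integral_sum) measurable
  also have "\<dots> = (\<Sum>l\<in>period_starts i. ennreal (l * Q l + (Q l)\<^sup>2 / 2))"
  proof (intro sum.cong refl)
    fix l assume "l \<in> period_starts i"
    then have "0 \<le> l" using release_nonneg assms by (auto simp: period_starts_def)
    moreover have "0 \<le> Q l"
      unfolding Q_def period_jobs_def using assms
      by (intro sum_nonneg less_imp_le[OF q_pos]) auto
    ultimately show "(\<integral>\<^sup>+t\<in>{l..l + Q l}. ennreal t \<partial>lborel) = ennreal (l * Q l + (Q l)\<^sup>2 / 2)"
      by (subst set_nn_integral_Icc_ident) (auto simp: power2_sum add_divide_distrib)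
  qed
  finally show ?thesis by (simp add: Q_def)
qed

lemma sum_mean_busy_le_mbt_feasible:
  assumes "mbt_feasible m" "i \<le> n"
  shows "(\<Sum>j=1..i. ennreal (q j * mean_busy j)) \<le> (\<Sum>j=1..i. ennreal (q j) * m j)"
proof -
  have "(\<Sum>j=1..i. ennreal (q j * mean_busy j))
      \<le> (\<Sum>l\<in>period_starts i. \<Sum>j\<in>period_jobs i l. ennreal (q j) * m j)"
  proof (rule order_trans[OF sum_mean_busy_le_periods[OF assms(2)]], rule sum_mono)
    fix l assume "l \<in> period_starts i"
    then have "0 \<le> l" using release_nonneg assms(2) by (auto simp: period_starts_def)
    moreover have "\<forall>j\<in>period_jobs i l. l \<le> r j"
      using period_start_le[OF assms(2) _ order_refl] by (auto simp: period_jobs_def)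
    moreover have "period_jobs i l \<subseteq> {1..n}" using assms(2) by (auto simp: period_jobs_def)
    ultimately show "ennreal (l * sum q (period_jobs i l) + (sum q (period_jobs i l))\<^sup>2 / 2)
        \<le> (\<Sum>j\<in>period_jobs i l. ennreal (q j) * m j)"
      using assms(1) by (simp add: mbt_feasible_def)
  qed
  also have "\<dots> = (\<Sum>j=1..i. ennreal (q j) * m j)"
    unfolding period_jobs_def
    using finite_period_starts period_start_in[OF assms(2) _ order_refl]
    by (intro sum.group) auto
  finally show ?thesis .
qed

lemma weighted_mean_busy_le_mbt_feasible:
  assumes "mbt_feasible m"
    and w: "\<And>j. j \<in> {1..n} \<Longrightarrow> 0 \<le> w j"
    and w_antimono: "\<And>i j. 1 \<le> i \<Longrightarrow> i \<le> j \<Longrightarrow> j \<le> n \<Longrightarrow> w j / q j \<le> w i / q i"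
  shows "ennreal (\<Sum>j=1..n. w j * mean_busy j) \<le> (\<Sum>j=1..n. ennreal (w j) * m j)"
proof -
  have weight: "ennreal (w j) = ennreal (w j / q j) * ennreal (q j)" if "j \<in> {1..n}" for j
    using w[OF that] q_pos[OF that] by (simp flip: ennreal_mult)
  have "ennreal (\<Sum>j=1..n. w j * mean_busy j) = (\<Sum>j=1..n. ennreal (w j * mean_busy j))"
    using w mean_busy_nonneg by (intro sum_ennreal[symmetric] mult_nonneg_nonneg) auto
  also have "\<dots> = (\<Sum>j=1..n. ennreal (w j / q j) * ennreal (q j * mean_busy j))"
  proof (intro sum.cong refl)
    fix j assume j: "j \<in> {1..n}"
    then have "w j * mean_busy j = w j / q j * (q j * mean_busy j)" "0 \<le> w j / q j"
      using w q_pos[OF j] by auto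
    then show "ennreal (w j * mean_busy j) = ennreal (w j / q j) * ennreal (q j * mean_busy j)"
      by (simp only: ennreal_mult')
  qed
  also have "\<dots> \<le> (\<Sum>j=1..n. ennreal (w j / q j) * (ennreal (q j) * m j))"
    using sum_mean_busy_le_mbt_feasible[OF assms(1)] w_antimono
    by (intro sum_antimono_weights_mono ennreal_leI) auto
  also have "\<dots> = (\<Sum>j=1..n. ennreal (w j) * m j)"
    by (intro sum.cong refl) (simp add: weight mult.assoc)
  finally show ?thesis .
qed

end

subsection \<open>FIFO service\<close>

text \<open>\<open>V\<close> bounds the time at which a work-conserving server has dealt with everything ahead of \<open>j\<close>:
  it is busy either since the start or since the arrival of some job \<open>i\<close>.\<close>

lemma fifo_completion_le:
  assumes "sorted (map a js)" "distinct js" "j \<in> set js"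
    and "\<And>k. k \<in> set js \<Longrightarrow> 0 \<le> x k"
    and "T + sum x {k \<in> set js. k \<noteq> j \<and> a k \<le> a j} \<le> V" "a j \<le> V"
    and "\<And>i. i \<in> set js \<Longrightarrow> a i \<le> a j \<Longrightarrow> a i + sum x {k \<in> set js. k \<noteq> j \<and> a i \<le> a k \<and> a k \<le> a j} \<le> V"
  shows "fifo_completion a x T js j \<le> V + x j"
  using assms
proof (induction js arbitrary: T)
  case (Cons i js)
  show ?case
  proof (cases "i = j")
    case True
    have "0 \<le> sum x {k \<in> set (i # js). k \<noteq> j \<and> a k \<le> a j}"
      using Cons.prems(4) by (intro sum_nonneg) auto
    then have "max T (a j) \<le> V" using Cons.prems(5,6) by simp
    then show ?thesis using True by (simp add: Let_def)
  next
    case False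
    then have j: "j \<in> set js" using Cons.prems(3) by simp
    have i: "a i \<le> a j" "i \<notin> set js" "\<And>k. k \<in> set js \<Longrightarrow> a i \<le> a k"
      using Cons.prems(1,2) j by auto
    define K where "K = {k \<in> set js. k \<noteq> j \<and> a k \<le> a j}"
    have "{k \<in> set (i # js). k \<noteq> j \<and> a k \<le> a j} = insert i K"
      "{k \<in> set (i # js). k \<noteq> j \<and> a i \<le> a k \<and> a k \<le> a j} = insert i K"
      using False i by (auto simp: K_def)
    moreover have "sum x (insert i K) = x i + sum x K" using i(2) by (simp add: K_def)
    ultimately have "max T (a i) + x i + sum x K \<le> V"
      using Cons.prems(5) Cons.prems(7)[of i] i(1) by (simp add: max_def)
    moreover have "a h + sum x {k \<in> set js. k \<noteq> j \<and> a h \<le> a k \<and> a k \<le> a j} \<le> V"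
      if "h \<in> set js" "a h \<le> a j" for h
    proof -
      have "sum x {k \<in> set js. k \<noteq> j \<and> a h \<le> a k \<and> a k \<le> a j}
          \<le> sum x {k \<in> set (i # js). k \<noteq> j \<and> a h \<le> a k \<and> a k \<le> a j}"
        using Cons.prems(4) by (intro sum_mono2) auto
      then show ?thesis using Cons.prems(7)[of h] that by auto
    qed
    ultimately have "fifo_completion a x (max T (a i) + x i) js j \<le> V + x j"
      using Cons.prems j by (intro Cons.IH) (auto simp: K_def)
    then show ?thesis using False by (simp add: Let_def)
  qed
qed simp

context preemptive_schedule
begin

text \<open>The virtual machine has unit speed, so the virtual work done on the jobs between their queue
  entries and that of \<open>j\<close> fits into the elapsed time, and only the excess over it delays \<open>j\<close>.\<close>

lemma backlog_le_excess:
  assumes j: "j \<in> {1..n}" and \<alpha>: "\<And>k. k \<in> {1..n} \<Longrightarrow> \<alpha> k \<in> {0<..1}"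
    and s: "0 \<le> s" "s \<le> apoint j (\<alpha> j)"
    and L: "L \<subseteq> {1..n}" "\<And>k. k \<in> L \<Longrightarrow> s \<le> apoint k (\<alpha> k)"
  shows "s + sum x L
    \<le> apoint j (\<alpha> j) + (\<Sum>k\<in>L. max 0 (x k - (progress j k (\<alpha> j) - \<alpha> k) * q k))"
proof -
  define C where "C = apoint j (\<alpha> j)"
  define v where "v = (\<lambda>k. (progress j k (\<alpha> j) - \<alpha> k) * q k)"
  have fin: "finite L" using L(1) finite_subset by blast
  have "sum v L \<le> (\<Sum>k\<in>L. work k C - work k s)"
  proof (rule sum_mono)
    fix k assume "k \<in> L"
    then have k: "k \<in> {1..n}" "s \<le> apoint k (\<alpha> k)" using L by auto
    then have "v k = work k C - work k (apoint k (\<alpha> k))"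
      using \<alpha>[OF k(1)] q_pos[OF k(1)]
      by (simp add: v_def C_def progress_def left_diff_distrib work_apoint)
    then show "v k \<le> work k C - work k s" using sp_work_mono[OF s(1) k(2)] by simp
  qed
  also have "\<dots> \<le> C - s"
    using s L(1) fin by (intro sum_sp_work_diff_le) (auto simp: C_def)
  finally have "s + sum x L \<le> C + (\<Sum>k\<in>L. x k - v k)" by (simp add: sum_subtractf)
  also have "\<dots> \<le> C + (\<Sum>k\<in>L. max 0 (x k - v k))" by (intro add_left_mono sum_mono) simp
  finally show ?thesis by (simp add: C_def v_def)
qed

lemma rsos_completion_le:
  assumes j: "j \<in> {1..n}" and \<alpha>: "\<And>k. k \<in> {1..n} \<Longrightarrow> \<alpha> k \<in> {0<..1}"
    and x: "\<And>k. k \<in> {1..n} \<Longrightarrow> 0 \<le> x k"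
  shows "rsos_completion n r q \<alpha> x j \<le> apoint j (\<alpha> j) + x j + (\<Sum>k\<in>{1..n} - {j}.
    if \<alpha> k \<le> progress j k (\<alpha> j) then max 0 (x k - (progress j k (\<alpha> j) - \<alpha> k) * q k) else 0)"
proof -
  define a where "a = (\<lambda>k. apoint k (\<alpha> k))"
  define js where "js = sort_key a [1..<Suc n]"
  define e where "e = (\<lambda>k. max 0 (x k - (progress j k (\<alpha> j) - \<alpha> k) * q k))"
  define K where "K = {k \<in> {1..n}. k \<noteq> j \<and> a k \<le> a j}"
  have js: "set js = {1..n}" "sorted (map a js)" "distinct js"
    by (simp_all add: js_def atLeastLessThanSuc_atLeastAtMost del: upt_Suc)
  have a_nonneg: "0 \<le> a k" if "k \<in> {1..n}" for k
    using that \<alpha>[OF that] by (auto simp: a_def intro!: apoint_nonneg)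
  have backlog: "s + sum x L \<le> a j + sum e K"
    if "0 \<le> s" "s \<le> a j" "L \<subseteq> K" "\<And>k. k \<in> L \<Longrightarrow> s \<le> a k" for s L
  proof -
    have "s + sum x L \<le> a j + sum e L"
      unfolding a_def e_def by (rule backlog_le_excess) (use j \<alpha> that in \<open>auto simp: a_def K_def\<close>)
    also have "sum e L \<le> sum e K" using that(3) by (intro sum_mono2) (auto simp: e_def K_def)
    finally show ?thesis by simp
  qed
  have "fifo_completion a x 0 js j \<le> a j + sum e K + x j"
  proof (rule fifo_completion_le)
    show "0 + sum x {k \<in> set js. k \<noteq> j \<and> a k \<le> a j} \<le> a j + sum e K"
      using j a_nonneg by (intro backlog) (auto simp: js K_def)
    show "a j \<le> a j + sum e K" by (simp add: e_def sum_nonneg)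
    show "a i + sum x {k \<in> set js. k \<noteq> j \<and> a i \<le> a k \<and> a k \<le> a j} \<le> a j + sum e K"
      if "i \<in> set js" "a i \<le> a j" for i
      using that a_nonneg by (intro backlog) (auto simp: js K_def)
  qed (use j x js in auto)
  moreover have "a k \<le> a j \<longleftrightarrow> \<alpha> k \<le> progress j k (\<alpha> j)" if "k \<in> {1..n}" for k
    using that \<alpha>[OF that] a_nonneg[OF j] apoint_le_iff[of k "\<alpha> k" "a j"] q_pos[OF that]
    by (simp add: a_def progress_def pos_le_divide_eq)
  then have "K = {k \<in> {1..n} - {j}. \<alpha> k \<le> progress j k (\<alpha> j)}" by (auto simp: K_def)
  then have "sum e K = (\<Sum>k\<in>{1..n} - {j}. if \<alpha> k \<le> progress j k (\<alpha> j) then e k else 0)"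
    by (simp only: sum.inter_filter[symmetric] finite_Diff finite_atLeastAtMost)
  moreover have "rsos_completion n r q \<alpha> x = fifo_completion a x 0 js"
    by (simp only: rsos_completion_def Let_def js_def a_def)
  ultimately show ?thesis unfolding a_def e_def by simp
qed

end

subsection \<open>Expected excess of NBUE processing times\<close>

text \<open>This sharpened Markov inequality and the NBUE property at the single point \<open>t\<close> suffice to
  bound the expected excess: no differential inequality for the integrated tail is needed.\<close>

lemma (in prob_space) expectation_excess_plus_tail_le:
  fixes X :: "'a \<Rightarrow> real"
  assumes "integrable M X" "AE \<omega> in M. 0 \<le> X \<omega>"
  shows "expectation (\<lambda>\<omega>. max 0 (X \<omega> - t)) + t * \<P>(\<omega> in M. t < X \<omega>) \<le> expectation X"
proof -
  define A where "A = {\<omega> \<in> space M. t < X \<omega>}"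
  have [measurable]: "X \<in> borel_measurable M" using assms(1) by auto
  have A [measurable]: "A \<in> events" unfolding A_def by measurable
  have int: "integrable M (\<lambda>\<omega>. max 0 (X \<omega> - t))" "integrable M (\<lambda>\<omega>. t * indicator A \<omega>)"
    using assms(1) by (auto simp: emeasure_eq_measure)
  have "expectation (\<lambda>\<omega>. max 0 (X \<omega> - t)) + t * prob A
      = expectation (\<lambda>\<omega>. max 0 (X \<omega> - t) + t * indicator A \<omega>)"
    using int by (subst Bochner_Integration.integral_add) auto
  also have "\<dots> \<le> expectation X"
  proof (rule integral_mono_AE)
    show "AE \<omega> in M. max 0 (X \<omega> - t) + t * indicator A \<omega> \<le> X \<omega>"
      using assms(2) AE_space by eventually_elim (auto simp: A_def indicator_def)
  qed (use int assms(1) in auto)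
  finally show ?thesis by (simp add: A_def)
qed

lemma (in prob_space) delta_NBUE_excess_le_tail:
  assumes "integrable M X" "delta_NBUE M \<delta> X" "0 \<le> t"
  shows "expectation (\<lambda>\<omega>. max 0 (X \<omega> - t)) \<le> \<delta> * expectation X * \<P>(\<omega> in M. t < X \<omega>)"
proof -
  define A where "A = {\<omega> \<in> space M. t < X \<omega>}"
  have [measurable]: "X \<in> borel_measurable M" using assms(1) by auto
  have A [measurable]: "A \<in> events" unfolding A_def by measurable
  have excess: "expectation (\<lambda>\<omega>. max 0 (X \<omega> - t)) = (LINT \<omega>:A|M. X \<omega> - t)"
    unfolding set_lebesgue_integral_def
    by (intro Bochner_Integration.integral_cong) (auto simp: A_def indicator_def)
  show ?thesis
  proof (cases "prob A > 0")
    case True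
    then show ?thesis
      using assms(2,3) unfolding delta_NBUE_def excess A_def[symmetric]
      by (auto simp: A_def pos_divide_le_eq)
  next
    case False
    then have "prob A = 0" using measure_nonneg[of M A] by linarith
    then have "AE \<omega> in M. \<omega> \<notin> A" using prob_eq_0[OF A] by simp
    then have "(LINT \<omega>:A|M. X \<omega> - t) = 0"
      unfolding set_lebesgue_integral_def by (intro integral_eq_zero_AE) auto
    then show ?thesis using \<open>prob A = 0\<close> by (simp add: excess A_def)
  qed
qed

lemma (in prob_space) delta_NBUE_expectation_excess_le:
  assumes "integrable M X" "AE \<omega> in M. 0 \<le> X \<omega>" "delta_NBUE M \<delta> X"
    and \<delta>: "0 < \<delta>" and y: "0 \<le> y" and "0 < expectation X"
  shows "expectation (\<lambda>\<omega>. max 0 (X \<omega> - y * expectation X)) \<le> expectation X * (\<delta> / (\<delta> + y))"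
proof -
  let ?\<mu> = "expectation X"
  define g where "g = expectation (\<lambda>\<omega>. max 0 (X \<omega> - y * ?\<mu>))"
  define P where "P = \<P>(\<omega> in M. y * ?\<mu> < X \<omega>)"
  have "y * g \<le> y * (\<delta> * ?\<mu> * P)"
    unfolding g_def P_def using assms
    by (intro mult_left_mono delta_NBUE_excess_le_tail) auto
  moreover have "\<delta> * (g + y * ?\<mu> * P) \<le> \<delta> * ?\<mu>"
    unfolding g_def P_def using assms
    by (intro mult_left_mono expectation_excess_plus_tail_le) auto
  ultimately have "g * (\<delta> + y) \<le> ?\<mu> * \<delta>" by (simp add: algebra_simps)
  then show ?thesis using \<delta> y by (simp add: g_def pos_le_divide_eq)
qed

subsection \<open>The distribution of the \<open>\<alpha>\<close>-points\<close>

lemma mono_zero_one_threshold: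
  fixes h :: "real \<Rightarrow> real"
  assumes zero_one: "\<And>a. a \<in> {0<..1} \<Longrightarrow> h a \<in> {0, 1}"
    and mono: "\<And>a b. 0 < a \<Longrightarrow> a \<le> b \<Longrightarrow> b \<le> 1 \<Longrightarrow> h a \<le> h b"
  shows "\<exists>m\<in>{0..1}. \<forall>a\<in>{0<..1}. a \<noteq> m \<longrightarrow> h a = indicator {m<..} a"
proof -
  define S where "S = insert 1 {a \<in> {0<..1}. h a = 1}"
  define m where "m = Inf S"
  have S: "S \<noteq> {}" "bdd_below S" by (auto simp: S_def intro!: bdd_belowI[of _ 0])
  have "0 \<le> m" unfolding m_def by (rule cInf_greatest[OF S(1)]) (auto simp: S_def)
  moreover have "m \<le> 1" unfolding m_def by (rule cInf_lower[OF _ S(2)]) (simp add: S_def)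
  moreover have "h a = indicator {m<..} a" if a: "a \<in> {0<..1}" "a \<noteq> m" for a
  proof (cases "a < m")
    case True
    then have "a \<notin> S" using cInf_lower[OF _ S(2), of a] by (auto simp: m_def)
    then show ?thesis using True a zero_one[of a] by (auto simp: S_def)
  next
    case False
    then obtain b where "b \<in> S" "b < a"
      using a(2) cInf_less_iff[OF S, of a] by (auto simp: m_def)
    then show ?thesis using a False mono[of b a] zero_one[of a] by (auto simp: S_def)
  qed
  ultimately show ?thesis by (intro bexI[of _ m]) auto
qed

locale unit_density =
  fixes f :: "real \<Rightarrow> real"
  assumes pdf: "pdf_on_unit f"
begin

definition alpha_dist :: "real measure" where
  "alpha_dist = density lborel (\<lambda>y. ennreal (indicator {0<..1} y * f y))"

lemma f_nonneg: "x \<in> {0<..1} \<Longrightarrow> 0 \<le> f x"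
  using pdf by (auto simp: pdf_on_unit_def)

lemma f_integrable: "integrable lborel (\<lambda>y. indicator {0<..1} y * f y)"
  using pdf by (auto simp: pdf_on_unit_def set_integrable_def)

lemma f_measurable [measurable]: "(\<lambda>y. indicator {0<..1} y * f y) \<in> borel_measurable borel"
  using f_integrable by auto

lemma sets_alpha_dist [measurable_cong, simp]: "sets alpha_dist = sets borel"
  by (simp add: alpha_dist_def)

lemma AE_alpha_dist: "(AE a in lborel. a \<in> {0<..1} \<longrightarrow> P a) \<Longrightarrow> AE a in alpha_dist. P a"
  unfolding alpha_dist_def by (subst AE_density) (measurable, auto simp: indicator_def)

lemma AE_alpha_dist_unit: "AE a in alpha_dist. a \<in> {0<..1}"
  by (rule AE_alpha_dist) simp

sublocale alpha: prob_space alpha_dist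
proof
  have "emeasure alpha_dist (space alpha_dist)
      = (\<integral>\<^sup>+y. ennreal (indicator {0<..1} y * f y) \<partial>lborel)"
    by (simp add: alpha_dist_def emeasure_density)
  also have "\<dots> = ennreal (LBINT y. indicator {0<..1} y * f y)"
    using f_nonneg by (intro nn_integral_eq_integral f_integrable) (auto simp: indicator_def)
  also have "\<dots> = 1" using pdf by (simp add: pdf_on_unit_def set_lebesgue_integral_def)
  finally show "emeasure alpha_dist (space alpha_dist) = 1" .
qed

lemma expectation_alpha_dist:
  assumes "h \<in> borel_measurable borel"
  shows "alpha.expectation h = (LBINT a:{0<..1}. h a * f a)"
proof -
  have "alpha.expectation h = (LBINT a. (indicator {0<..1} a * f a) *\<^sub>R h a)"
    unfolding alpha_dist_def
  proof (rule integral_density)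
    show "AE a in lborel. 0 \<le> indicator {0<..1} a * f a"
      using f_nonneg by (auto simp: indicator_def)
  qed (use assms in measurable)
  then show ?thesis by (simp add: set_lebesgue_integral_def mult_ac)
qed

lemma integrable_alpha [simp]: "integrable alpha_dist (\<lambda>a. a)"
proof (rule alpha.integrable_const_bound)
  show "AE a in alpha_dist. norm a \<le> 1" using AE_alpha_dist_unit by eventually_elim simp
qed simp

end

locale rsos_density = unit_density f for f +
  fixes \<delta> c :: real
  assumes \<delta>_ge_1: "1 \<le> \<delta>"
    and lower_condition: "x \<in> {0<..1} \<Longrightarrow> (LBINT \<alpha>:{0<..x}. \<delta> / (\<delta> + x - \<alpha>) * f \<alpha>) \<le> (c - 1) * x"
    and upper_condition: "x \<in> {0<..1} \<Longrightarrow>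
           (1 + (LBINT \<alpha>:{0<..1}. \<delta> / (\<delta> + 1 - \<alpha>) * f \<alpha>)) * (LBINT \<alpha>:{1-x<..1}. f \<alpha>) \<le> c * x"
begin

definition overrun_ratio :: "real \<Rightarrow> real \<Rightarrow> real" where
  "overrun_ratio x b = (if b \<le> x then \<delta> / (\<delta> + x - b) else 0)"

definition overrun :: "real \<Rightarrow> real" where
  "overrun x = alpha.expectation (overrun_ratio x)"

lemma overrun_ratio_nonneg: "0 \<le> overrun_ratio x b"
  and overrun_ratio_le_1: "overrun_ratio x b \<le> 1"
  using \<delta>_ge_1 by (auto simp: overrun_ratio_def divide_le_eq)

lemma overrun_ratio_measurable [measurable]:
  "case_prod overrun_ratio \<in> borel_measurable (borel \<Otimes>\<^sub>M borel)"
  unfolding overrun_ratio_def by measurable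

lemma integrable_overrun_ratio: "integrable alpha_dist (overrun_ratio x)"
  using overrun_ratio_nonneg overrun_ratio_le_1
  by (intro alpha.integrable_const_bound[of _ 1]) auto

lemma overrun_measurable [measurable]: "overrun \<in> borel_measurable borel"
  unfolding overrun_def by measurable

lemma nn_integral_overrun_ratio:
  "(\<integral>\<^sup>+b. ennreal (overrun_ratio x b) \<partial>alpha_dist) = ennreal (overrun x)"
  unfolding overrun_def using overrun_ratio_nonneg
  by (intro nn_integral_eq_integral integrable_overrun_ratio) auto

lemma overrun_nonneg: "0 \<le> overrun x"
  unfolding overrun_def
  using overrun_ratio_nonneg by (simp add: Bochner_Integration.integral_nonneg)

lemma overrun_le_1: "overrun x \<le> 1"
  unfolding overrun_def
  using alpha.integral_le_const[OF integrable_overrun_ratio] overrun_ratio_le_1 by simp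

lemma overrun_eq:
  assumes "0 \<le> x" "x \<le> 1"
  shows "overrun x = (LBINT \<alpha>:{0<..x}. \<delta> / (\<delta> + x - \<alpha>) * f \<alpha>)"
proof -
  have "overrun x = (LBINT b:{0<..1}. overrun_ratio x b * f b)"
    unfolding overrun_def by (rule expectation_alpha_dist) measurable
  also have "\<dots> = (LBINT \<alpha>:{0<..x}. \<delta> / (\<delta> + x - \<alpha>) * f \<alpha>)"
    unfolding set_lebesgue_integral_def
    using assms
    by (intro Bochner_Integration.integral_cong) (auto simp: overrun_ratio_def indicator_def)
  finally show ?thesis .
qed

lemma overrun_0: "overrun 0 = 0"
  by (simp add: overrun_eq set_lebesgue_integral_def)

lemma overrun_le:
  assumes "0 \<le> x" "x \<le> 1"
  shows "overrun x \<le> (c - 1) * x"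
  using assms lower_condition[of x] overrun_eq[of x] overrun_0 by (cases "x = 0") auto

lemma c_ge_1: "1 \<le> c"
  using overrun_le[of 1] overrun_nonneg[of 1] by simp

lemma expectation_alpha_le: "alpha.expectation (\<lambda>a. a) \<le> c - 1"
proof -
  have "alpha.expectation (\<lambda>a. a) \<le> overrun 1"
    unfolding overrun_def
  proof (rule integral_mono_AE)
    show "AE a in alpha_dist. a \<le> overrun_ratio 1 a"
      using AE_alpha_dist_unit
    proof eventually_elim
      case (elim a)
      have "0 \<le> (\<delta> - a) * (1 - a)" using elim \<delta>_ge_1 by (intro mult_nonneg_nonneg) auto
      then show ?case
        using elim \<delta>_ge_1 by (simp add: overrun_ratio_def pos_le_divide_eq algebra_simps)
    qed
  qed (auto intro: integrable_overrun_ratio)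
  then show ?thesis using overrun_le[of 1] by simp
qed

lemma upper_tail_le:
  assumes "0 \<le> m" "m \<le> 1"
  shows "(1 + overrun 1) * alpha.prob {m<..} \<le> c * (1 - m)"
proof -
  have "alpha.prob {m<..} = (LBINT b:{0<..1}. indicator {m<..} b * f b)"
    using expectation_alpha_dist[of "indicator {m<..}"] by simp
  also have "\<dots> = (LBINT b:{m<..1}. f b)"
    unfolding set_lebesgue_integral_def
    using assms by (intro Bochner_Integration.integral_cong) (auto simp: indicator_def)
  finally have "alpha.prob {m<..} = (LBINT b:{m<..1}. f b)" .
  then show ?thesis
    using upper_condition[of "1 - m"] overrun_eq[of 1] assms
    by (cases "m = 1") (auto simp: set_lebesgue_integral_def)
qed

lemma expectation_overrun_const_le:
  assumes [measurable]: "h \<in> borel_measurable borel"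
    and h: "\<And>a. a \<in> {0<..1} \<Longrightarrow> h a = x" and x: "0 \<le> x" "x \<le> 1"
  shows "alpha.expectation (\<lambda>a. h a + overrun (h a)) \<le> c * (LBINT a:{0<..1}. h a)"
proof -
  have "alpha.expectation (\<lambda>a. h a + overrun (h a)) = alpha.expectation (\<lambda>_. x + overrun x)"
    using h by (intro integral_cong_AE) (auto intro: eventually_mono[OF AE_alpha_dist_unit])
  also have "\<dots> = x + overrun x" by (simp add: alpha.prob_space[simplified])
  also have "\<dots> \<le> c * x" using overrun_le[OF x] by (simp add: algebra_simps)
  also have "x = (LBINT a:{0<..1::real}. x)" by (simp add: set_lebesgue_integral_def)
  also have "\<dots> = (LBINT a:{0<..1}. h a)"
    using h by (intro set_lebesgue_integral_cong) auto
  finally show ?thesis .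
qed

lemma expectation_overrun_step_le:
  assumes [measurable]: "h \<in> borel_measurable borel"
    and "\<And>a. a \<in> {0<..1} \<Longrightarrow> h a \<in> {0, 1}"
    and "\<And>a b. 0 < a \<Longrightarrow> a \<le> b \<Longrightarrow> b \<le> 1 \<Longrightarrow> h a \<le> h b"
  shows "alpha.expectation (\<lambda>a. h a + overrun (h a)) \<le> c * (LBINT a:{0<..1}. h a)"
proof -
  obtain m where m: "0 \<le> m" "m \<le> 1"
    and h: "\<And>a. a \<in> {0<..1} \<Longrightarrow> a \<noteq> m \<Longrightarrow> h a = indicator {m<..} a"
    using mono_zero_one_threshold[of h] assms(2,3) by (metis atLeastAtMost_iff)
  have "AE a in alpha_dist. a \<noteq> m" using AE_lborel_singleton[of m] by (intro AE_alpha_dist) auto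
  with AE_alpha_dist_unit
  have "AE a in alpha_dist. h a + overrun (h a) = (1 + overrun 1) * indicator {m<..} a"
    by eventually_elim (auto simp: h indicator_def overrun_0)
  then have "alpha.expectation (\<lambda>a. h a + overrun (h a))
      = alpha.expectation (\<lambda>a. (1 + overrun 1) * indicator {m<..} a)"
    by (intro integral_cong_AE) measurable
  also have "\<dots> = (1 + overrun 1) * alpha.prob {m<..}" by simp
  also have "\<dots> \<le> c * (1 - m)" by (rule upper_tail_le[OF m])
  also have "1 - m = (LBINT a. indicator {m<..1} a)" using m by simp
  also have "\<dots> = (LBINT a:{0<..1}. h a)"
    unfolding set_lebesgue_integral_def
  proof (rule integral_cong_AE)
    show "AE a in lborel. indicator {m<..1} a = indicator {0<..1} a *\<^sub>R h a"
      using AE_lborel_singleton[of m] by eventually_elim (use h m in \<open>auto simp: indicator_def\<close>)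
  qed measurable
  finally show ?thesis .
qed

end


subsection \<open>Expected \<open>\<alpha>\<close>-points and overruns\<close>

locale randomized_schedule = preemptive_schedule n r q + unit_density f for n r q f
begin

lemma integrable_apoint [simp]:
  assumes j: "j \<in> {1..n}"
  shows "integrable alpha_dist (apoint j)"
proof (rule alpha.integrable_const_bound)
  show "AE a in alpha_dist. norm (apoint j a) \<le> apoint j 1"
    using AE_alpha_dist_unit
    by eventually_elim (use apoint_nonneg[OF j] apoint_mono[OF j, of _ 1] in auto)
qed (use j in measurable)

lemma integrable_progress [simp]:
  "j \<in> {1..n} \<Longrightarrow> k \<in> {1..n} \<Longrightarrow> integrable alpha_dist (progress j k)"
  using progress_bounds[of k j] by (intro alpha.integrable_const_bound[of _ 1]) auto

lemma expectation_apoint: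
  assumes j: "j \<in> {1..n}"
  shows "alpha.expectation (apoint j) = idle_before j + q j * alpha.expectation (\<lambda>a. a)
    + (\<Sum>k\<in>{1..n} - {j}. q k * alpha.expectation (progress j k))"
proof -
  note [measurable] = apoint_measurable[OF j] progress_measurable[OF j]
  have "alpha.expectation (apoint j) = alpha.expectation (\<lambda>a. (idle_before j + q j * a)
      + (\<Sum>k\<in>{1..n} - {j}. q k * progress j k a))"
  proof (rule integral_cong_AE)
    show "AE a in alpha_dist. apoint j a = (idle_before j + q j * a)
        + (\<Sum>k\<in>{1..n} - {j}. q k * progress j k a)"
      using AE_alpha_dist_unit
      by eventually_elim (simp add: apoint_eq_idle_plus_progress[OF j])
  qed measurable
  also have "\<dots> = alpha.expectation (\<lambda>a. idle_before j + q j * a)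
      + alpha.expectation (\<lambda>a. \<Sum>k\<in>{1..n} - {j}. q k * progress j k a)"
    using j by (intro Bochner_Integration.integral_add Bochner_Integration.integrable_sum) auto
  also have "alpha.expectation (\<lambda>a. \<Sum>k\<in>{1..n} - {j}. q k * progress j k a)
      = (\<Sum>k\<in>{1..n} - {j}. q k * alpha.expectation (progress j k))"
    using j by (subst Bochner_Integration.integral_sum) auto
  finally show ?thesis by (simp add: alpha.prob_space[simplified])
qed

end

lemma (in preemptive_schedule) mean_busy_eq_idle_plus_progress:
  assumes j: "j \<in> {1..n}"
  shows "mean_busy j = idle_before j + q j / 2
    + (\<Sum>k\<in>{1..n} - {j}. q k * (LBINT a:{0<..1}. progress j k a))"
proof -
  note [measurable] = apoint_measurable[OF j] progress_measurable[OF j]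
  interpret uniform: randomized_schedule n r q "\<lambda>_. 1"
    by unfold_locales (simp add: pdf_on_unit_def set_integrable_def set_lebesgue_integral_def)
  have average: "uniform.alpha.expectation h = (LBINT a:{0<..1}. h a)"
    if "h \<in> borel_measurable borel" for h :: "real \<Rightarrow> real"
    using uniform.expectation_alpha_dist[OF that] by simp
  have "(LBINT a:{0<..1::real}. a) = (LBINT a. a ^ 1 * indicator {0..1} a)"
    unfolding set_lebesgue_integral_def
    by (intro Bochner_Integration.integral_cong) (auto simp: indicator_def)
  then have "(LBINT a:{0<..1::real}. a) = 1 / 2" by (simp only: integral_power) simp
  then show ?thesis
    using uniform.expectation_apoint[OF j] by (simp add: mean_busy_eq_average_apoint[OF j] average)
qed

locale rsos_analysis = randomized_schedule n r q f + rsos_density f \<delta> c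
  for n r q f \<delta> c
begin

lemma integrable_overrun_progress [simp]:
  "j \<in> {1..n} \<Longrightarrow> integrable alpha_dist (\<lambda>a. overrun (progress j k a))"
  using overrun_nonneg overrun_le_1 by (intro alpha.integrable_const_bound[of _ 1]) auto

lemma expectation_progress_overrun_le:
  assumes j: "j \<in> {1..n}" and k: "k \<in> {1..n} - {j}"
  shows "alpha.expectation (\<lambda>a. progress j k a + overrun (progress j k a))
    \<le> c * (LBINT a:{0<..1}. progress j k a)"
proof (cases "j < k")
  case True
  show ?thesis
    by (rule expectation_overrun_const_le[OF progress_measurable[OF j]
          progress_lower_priority[OF j True]])
       (use k progress_bounds in auto)
next
  case False
  then have "k \<in> {1..<j}" using k by auto
  show ?thesis
    by (rule expectation_overrun_step_le[OF progress_measurable[OF j]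
          progress_higher_priority[OF j \<open>k \<in> {1..<j}\<close>] progress_mono[OF j]])
       (use k in auto)
qed

lemma expectation_apoint_overrun_le:
  assumes j: "j \<in> {1..n}"
  shows "alpha.expectation (apoint j) + q j
      + (\<Sum>k\<in>{1..n} - {j}. q k * alpha.expectation (\<lambda>a. overrun (progress j k a)))
    \<le> c * (mean_busy j + q j / 2)"
proof -
  let ?K = "{1..n} - {j}"
  have "alpha.expectation (apoint j) + q j
      + (\<Sum>k\<in>?K. q k * alpha.expectation (\<lambda>a. overrun (progress j k a)))
    = idle_before j + q j * (1 + alpha.expectation (\<lambda>a. a))
      + (\<Sum>k\<in>?K. q k * alpha.expectation (\<lambda>a. progress j k a + overrun (progress j k a)))"
    using j by (simp add: expectation_apoint sum.distrib[symmetric] distrib_left)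
  also have "\<dots> \<le> c * idle_before j + q j * c
      + (\<Sum>k\<in>?K. q k * (c * (LBINT a:{0<..1}. progress j k a)))"
    using c_ge_1 idle_before_nonneg[OF j] expectation_alpha_le q_pos[OF j] q_pos
      mult_right_mono[of 1 c "idle_before j"] expectation_progress_overrun_le[OF j]
    by (intro add_mono sum_mono mult_left_mono) (auto intro: less_imp_le)
  also have "\<dots> = c * (mean_busy j + q j / 2)"
    by (simp add: mean_busy_eq_idle_plus_progress[OF j] sum_distrib_left algebra_simps)
  finally show ?thesis .
qed

end

subsection \<open>Expected cost of RSOS\<close>

locale stochastic_jobs = prob_space M + preemptive_schedule n r q
  for M :: "'a measure" and n r q +
  fixes p :: "nat \<Rightarrow> 'a \<Rightarrow> real"
  assumes p_nonneg: "j \<in> {1..n} \<Longrightarrow> AE \<omega> in M. 0 \<le> p j \<omega>"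
    and p_integrable: "j \<in> {1..n} \<Longrightarrow> integrable M (p j)"
    and q_eq: "\<And>j. q j = expectation (p j)"
begin

lemma p_measurable [measurable]: "j \<in> {1..n} \<Longrightarrow> p j \<in> borel_measurable M"
  by (rule borel_measurable_integrable[OF p_integrable])

end

locale rsos_jobs = stochastic_jobs M n r q p + rsos_analysis n r q f \<delta> c
  for M :: "'a measure" and n r q p f \<delta> c +
  assumes NBUE: "j \<in> {1..n} \<Longrightarrow> delta_NBUE M \<delta> (p j)"
begin

definition alphas :: "(nat \<Rightarrow> real) measure" where
  "alphas = PiM {1..n} (\<lambda>_. alpha_dist)"

sublocale alphas: prob_space alphas
  unfolding alphas_def by (intro prob_space_PiM alpha.prob_space_axioms)

sublocale jobs_alphas: pair_prob_space M alphas ..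

lemma alphas_component_measurable:
  "k \<in> {1..n} \<Longrightarrow> (\<lambda>\<alpha>. \<alpha> k) \<in> borel_measurable alphas"
  using measurable_component_singleton[of k "{1..n}" "\<lambda>_. alpha_dist"]
  by (simp add: alphas_def cong: measurable_cong_sets)

lemma AE_jobs_alphas:
  "AE z in M \<Otimes>\<^sub>M alphas. \<forall>k\<in>{1..n}. 0 \<le> p k (fst z) \<and> snd z k \<in> {0<..1}"
proof (intro AE_finite_allI jobs_alphas.AE_pair_measure)
  fix k assume k: "k \<in> {1..n}"
  note [measurable] = p_measurable[OF k] alphas_component_measurable[OF k]
  show "{z \<in> space (M \<Otimes>\<^sub>M alphas). 0 \<le> p k (fst z) \<and> snd z k \<in> {0<..1}} \<in> sets (M \<Otimes>\<^sub>M alphas)"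
    by measurable
  have "AE \<alpha> in alphas. \<alpha> k \<in> {0<..1}"
    unfolding alphas_def using AE_alpha_dist_unit k
    by (intro AE_PiM_component alpha.prob_space_axioms) auto
  then show "AE \<omega> in M. AE \<alpha> in alphas. 0 \<le> p k (fst (\<omega>, \<alpha>)) \<and> snd (\<omega>, \<alpha>) k \<in> {0<..1}"
    using p_nonneg[OF k] by simp
qed simp

definition excess :: "nat \<Rightarrow> nat \<Rightarrow> 'a \<Rightarrow> (nat \<Rightarrow> real) \<Rightarrow> real" where
  "excess j k \<omega> \<alpha> = (if \<alpha> k \<le> progress j k (\<alpha> j)
     then max 0 (p k \<omega> - (progress j k (\<alpha> j) - \<alpha> k) * q k) else 0)"

definition completion_bound :: "nat \<Rightarrow> 'a \<Rightarrow> (nat \<Rightarrow> real) \<Rightarrow> real" where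
  "completion_bound j \<omega> \<alpha> = apoint j (\<alpha> j) + p j \<omega> + (\<Sum>k\<in>{1..n} - {j}. excess j k \<omega> \<alpha>)"

lemma excess_nonneg: "0 \<le> excess j k \<omega> \<alpha>"
  by (simp add: excess_def)

lemma completion_bound_nonneg:
  assumes "j \<in> {1..n}" "0 \<le> p j \<omega>" "\<alpha> j \<in> {0<..1}"
  shows "0 \<le> completion_bound j \<omega> \<alpha>"
  using assms apoint_nonneg[of j "\<alpha> j"]
  by (simp add: completion_bound_def sum_nonneg excess_nonneg)

lemma excess_measurable:
  assumes "j \<in> {1..n}" "k \<in> {1..n}"
  shows "(\<lambda>z. excess j k (fst z) (snd z)) \<in> borel_measurable (M \<Otimes>\<^sub>M alphas)"
proof -
  note [measurable] = p_measurable[OF assms(2)] progress_measurable[OF assms(1)]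
    alphas_component_measurable[OF assms(1)] alphas_component_measurable[OF assms(2)]
  show ?thesis unfolding excess_def by measurable
qed

lemma completion_bound_measurable:
  assumes "j \<in> {1..n}"
  shows "(\<lambda>z. completion_bound j (fst z) (snd z)) \<in> borel_measurable (M \<Otimes>\<^sub>M alphas)"
proof -
  note [measurable] = p_measurable[OF assms] apoint_measurable[OF assms]
    alphas_component_measurable[OF assms] excess_measurable[OF assms]
  show ?thesis unfolding completion_bound_def by measurable
qed

lemma expectation_excess_given_alpha_le:
  assumes k: "k \<in> {1..n}"
  shows "(\<integral>\<^sup>+\<omega>. ennreal (excess j k \<omega> \<alpha>) \<partial>M)
    \<le> ennreal (q k) * ennreal (overrun_ratio (progress j k (\<alpha> j)) (\<alpha> k))"
proof (cases "\<alpha> k \<le> progress j k (\<alpha> j)")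
  case True
  define y where "y = progress j k (\<alpha> j) - \<alpha> k"
  have "(\<integral>\<^sup>+\<omega>. ennreal (excess j k \<omega> \<alpha>) \<partial>M) = ennreal (expectation (\<lambda>\<omega>. max 0 (p k \<omega> - y * q k)))"
    using True p_integrable[OF k] unfolding excess_def y_def
    by (subst nn_integral_eq_integral[symmetric]) auto
  also have "\<dots> \<le> ennreal (q k * (\<delta> / (\<delta> + y)))"
    using True \<delta>_ge_1 q_pos[OF k] unfolding q_eq[of k]
    by (intro ennreal_leI delta_NBUE_expectation_excess_le p_integrable p_nonneg NBUE k)
       (auto simp: y_def)
  also have "\<dots> = ennreal (q k) * ennreal (overrun_ratio (progress j k (\<alpha> j)) (\<alpha> k))"
    using True q_pos[OF k] by (simp add: overrun_ratio_def y_def add_diff_eq flip: ennreal_mult')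
  finally show ?thesis .
qed (simp add: excess_def)

lemma nn_integral_excess_le:
  assumes j: "j \<in> {1..n}" and k: "k \<in> {1..n} - {j}"
  shows "(\<integral>\<^sup>+z. ennreal (excess j k (fst z) (snd z)) \<partial>(M \<Otimes>\<^sub>M alphas))
    \<le> ennreal (q k * alpha.expectation (\<lambda>a. overrun (progress j k a)))"
proof -
  have k': "k \<in> {1..n}" "0 \<le> q k" using k q_pos[of k] by auto
  note [measurable] = progress_measurable[OF j] excess_measurable[OF j k'(1)]
  have excess: "(\<lambda>z. ennreal (excess j k (fst z) (snd z))) \<in> borel_measurable (M \<Otimes>\<^sub>M alphas)"
    by measurable
  have "(\<integral>\<^sup>+z. ennreal (excess j k (fst z) (snd z)) \<partial>(M \<Otimes>\<^sub>M alphas))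
      = (\<integral>\<^sup>+\<alpha>. \<integral>\<^sup>+\<omega>. ennreal (excess j k \<omega> \<alpha>) \<partial>M \<partial>alphas)"
    unfolding jobs_alphas.nn_integral_snd[OF excess, symmetric] by simp
  also have "\<dots> \<le> (\<integral>\<^sup>+\<alpha>. ennreal (q k) * ennreal (overrun_ratio (progress j k (\<alpha> j)) (\<alpha> k)) \<partial>alphas)"
    by (intro nn_integral_mono expectation_excess_given_alpha_le k')
  also have "\<dots> = (\<integral>\<^sup>+a. \<integral>\<^sup>+b. ennreal (q k) * ennreal (overrun_ratio (progress j k a) b)
      \<partial>alpha_dist \<partial>alpha_dist)"
    unfolding alphas_def using j k
    by (intro nn_integral_PiM_two_components alpha.prob_space_axioms) auto
  also have "\<dots> = (\<integral>\<^sup>+a. ennreal (q k) * ennreal (overrun (progress j k a)) \<partial>alpha_dist)"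
    unfolding nn_integral_overrun_ratio[symmetric]
    by (intro nn_integral_cong nn_integral_cmult) measurable
  also have "\<dots> = ennreal (q k) * ennreal (alpha.expectation (\<lambda>a. overrun (progress j k a)))"
    using j overrun_nonneg by (simp add: nn_integral_cmult nn_integral_eq_integral)
  finally show ?thesis using k' by (simp add: ennreal_mult')
qed

lemma AE_apoint_nonneg: "j \<in> {1..n} \<Longrightarrow> AE a in alpha_dist. 0 \<le> apoint j a"
  using AE_alpha_dist_unit by eventually_elim (simp add: apoint_nonneg)

lemma nn_integral_random_apoint:
  assumes j: "j \<in> {1..n}"
  shows "(\<integral>\<^sup>+z. ennreal (apoint j (snd z j)) \<partial>(M \<Otimes>\<^sub>M alphas))
    = ennreal (alpha.expectation (apoint j))"
proof -
  note [measurable] = apoint_measurable[OF j] alphas_component_measurable[OF j]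
  have "(\<lambda>z. ennreal (apoint j (snd z j))) \<in> borel_measurable (M \<Otimes>\<^sub>M alphas)" by measurable
  from jobs_alphas.nn_integral_snd[OF this]
  have "(\<integral>\<^sup>+z. ennreal (apoint j (snd z j)) \<partial>(M \<Otimes>\<^sub>M alphas))
      = (\<integral>\<^sup>+\<alpha>. ennreal (apoint j (\<alpha> j)) \<partial>alphas)"
    by (simp add: emeasure_space_1)
  also have "\<dots> = (\<integral>\<^sup>+a. ennreal (apoint j a) \<partial>alpha_dist)"
    unfolding alphas_def using j alpha.prob_space_axioms
    by (intro nn_integral_PiM_component[where g="\<lambda>a. ennreal (apoint j a)"])
       (auto cong: measurable_cong_sets)
  finally show ?thesis using j AE_apoint_nonneg[OF j] by (simp add: nn_integral_eq_integral)
qed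

lemma nn_integral_processing_time:
  assumes j: "j \<in> {1..n}"
  shows "(\<integral>\<^sup>+z. ennreal (p j (fst z)) \<partial>(M \<Otimes>\<^sub>M alphas)) = ennreal (q j)"
  using p_measurable[OF j] p_integrable[OF j] p_nonneg[OF j]
  by (subst alphas.nn_integral_fst[symmetric])
     (auto simp: alphas.emeasure_space_1 q_eq nn_integral_eq_integral)

lemma nn_integral_completion_bound:
  assumes j: "j \<in> {1..n}"
  shows "(\<integral>\<^sup>+z. ennreal (completion_bound j (fst z) (snd z)) \<partial>(M \<Otimes>\<^sub>M alphas))
    = ennreal (alpha.expectation (apoint j)) + ennreal (q j)
      + (\<Sum>k\<in>{1..n} - {j}. \<integral>\<^sup>+z. ennreal (excess j k (fst z) (snd z)) \<partial>(M \<Otimes>\<^sub>M alphas))"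
proof -
  let ?N = "M \<Otimes>\<^sub>M alphas" and ?K = "{1..n} - {j}"
  note [measurable] = apoint_measurable[OF j] p_measurable[OF j] alphas_component_measurable[OF j]
  have excess: "(\<lambda>z. ennreal (excess j k (fst z) (snd z))) \<in> borel_measurable ?N" if "k \<in> ?K" for k
    using excess_measurable[OF j, of k] that by auto
  have "AE z in ?N. ennreal (completion_bound j (fst z) (snd z))
      = (ennreal (apoint j (snd z j)) + ennreal (p j (fst z)))
        + (\<Sum>k\<in>?K. ennreal (excess j k (fst z) (snd z)))"
    using AE_jobs_alphas
  proof eventually_elim
    case (elim z)
    then have "0 \<le> p j (fst z)" "snd z j \<in> {0<..1}" using j by blast+
    then show ?case
      using apoint_nonneg[OF j, of "snd z j"]
      by (simp add: completion_bound_def excess_nonneg sum_nonneg)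
  qed
  then have "(\<integral>\<^sup>+z. ennreal (completion_bound j (fst z) (snd z)) \<partial>?N)
      = (\<integral>\<^sup>+z. (ennreal (apoint j (snd z j)) + ennreal (p j (fst z)))
          + (\<Sum>k\<in>?K. ennreal (excess j k (fst z) (snd z))) \<partial>?N)"
    by (rule nn_integral_cong_AE)
  also have "\<dots> = (\<integral>\<^sup>+z. ennreal (apoint j (snd z j)) + ennreal (p j (fst z)) \<partial>?N)
      + (\<integral>\<^sup>+z. (\<Sum>k\<in>?K. ennreal (excess j k (fst z) (snd z))) \<partial>?N)"
    by (intro nn_integral_add borel_measurable_sum excess) measurable
  also have "\<dots> = ennreal (alpha.expectation (apoint j)) + ennreal (q j)
      + (\<Sum>k\<in>?K. \<integral>\<^sup>+z. ennreal (excess j k (fst z) (snd z)) \<partial>?N)"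
    by (simp only: nn_integral_sum[OF excess])
       (simp add: nn_integral_add nn_integral_random_apoint[OF j] nn_integral_processing_time[OF j])
  finally show ?thesis .
qed

lemma nn_integral_completion_bound_le:
  assumes j: "j \<in> {1..n}"
  shows "(\<integral>\<^sup>+z. ennreal (completion_bound j (fst z) (snd z)) \<partial>(M \<Otimes>\<^sub>M alphas))
    \<le> ennreal (c * (mean_busy j + q j / 2))"
proof -
  let ?K = "{1..n} - {j}"
  have overrun_term: "0 \<le> q k * alpha.expectation (\<lambda>a. overrun (progress j k a))" if "k \<in> ?K" for k
    using that q_pos[of k] overrun_nonneg by (simp add: Bochner_Integration.integral_nonneg)
  have "(\<integral>\<^sup>+z. ennreal (completion_bound j (fst z) (snd z)) \<partial>(M \<Otimes>\<^sub>M alphas))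
      \<le> ennreal (alpha.expectation (apoint j)) + ennreal (q j)
        + (\<Sum>k\<in>?K. ennreal (q k * alpha.expectation (\<lambda>a. overrun (progress j k a))))"
    unfolding nn_integral_completion_bound[OF j]
    by (intro add_left_mono sum_mono nn_integral_excess_le[OF j])
  also have "\<dots> = ennreal (alpha.expectation (apoint j) + q j
      + (\<Sum>k\<in>?K. q k * alpha.expectation (\<lambda>a. overrun (progress j k a))))"
    using integral_nonneg_AE[OF AE_apoint_nonneg[OF j]] q_pos[OF j]
      sum_nonneg[of ?K, OF overrun_term]
    by (simp only: sum_ennreal[OF overrun_term] ennreal_plus add_nonneg_nonneg less_imp_le)
  also have "\<dots> \<le> ennreal (c * (mean_busy j + q j / 2))"
    by (intro ennreal_leI expectation_apoint_overrun_le j)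
  finally show ?thesis .
qed

lemma rsos_cost_le:
  assumes w: "\<And>j. j \<in> {1..n} \<Longrightarrow> 0 \<le> w j"
  shows "rsos_cost n w r M p f \<le> ennreal (c * (\<Sum>j=1..n. w j * (mean_busy j + q j / 2)))"
proof -
  let ?N = "M \<Otimes>\<^sub>M alphas"
  have "rsos_cost n w r M p f
      = (\<integral>\<^sup>+z. ennreal (\<Sum>j=1..n. w j * rsos_completion n r q (snd z) (\<lambda>k. p k (fst z)) j) \<partial>?N)"
    unfolding rsos_cost_def alpha_dist_def[symmetric] alphas_def q_eq[symmetric] case_prod_beta' ..
  also have "\<dots>
      \<le> (\<integral>\<^sup>+z. (\<Sum>j=1..n. ennreal (w j) * ennreal (completion_bound j (fst z) (snd z))) \<partial>?N)"
  proof (rule nn_integral_mono_AE)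
    show "AE z in ?N. ennreal (\<Sum>j=1..n. w j * rsos_completion n r q (snd z) (\<lambda>k. p k (fst z)) j)
        \<le> (\<Sum>j=1..n. ennreal (w j) * ennreal (completion_bound j (fst z) (snd z)))"
      using AE_jobs_alphas
    proof eventually_elim
      case (elim z)
      have "ennreal (\<Sum>j=1..n. w j * rsos_completion n r q (snd z) (\<lambda>k. p k (fst z)) j)
          \<le> ennreal (\<Sum>j=1..n. w j * completion_bound j (fst z) (snd z))"
        unfolding completion_bound_def excess_def
        using elim w by (intro ennreal_leI sum_mono mult_left_mono rsos_completion_le) auto
      also have "\<dots> = (\<Sum>j=1..n. ennreal (w j * completion_bound j (fst z) (snd z)))"
        using elim w
        by (intro sum_ennreal[symmetric] mult_nonneg_nonneg completion_bound_nonneg) auto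
      also have "\<dots> = (\<Sum>j=1..n. ennreal (w j) * ennreal (completion_bound j (fst z) (snd z)))"
        using w by (intro sum.cong refl ennreal_mult') auto
      finally show ?case .
    qed
  qed
  also have "\<dots>
      = (\<Sum>j=1..n. ennreal (w j) * (\<integral>\<^sup>+z. ennreal (completion_bound j (fst z) (snd z)) \<partial>?N))"
    using completion_bound_measurable
    by (subst nn_integral_sum) (auto intro!: sum.cong nn_integral_cmult)
  also have "\<dots> \<le> (\<Sum>j=1..n. ennreal (w j) * ennreal (c * (mean_busy j + q j / 2)))"
    by (intro sum_mono mult_left_mono nn_integral_completion_bound_le) auto
  also have "\<dots> = ennreal (\<Sum>j=1..n. w j * (c * (mean_busy j + q j / 2)))"
    using w c_ge_1 mean_busy_nonneg q_pos[THEN less_imp_le]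
    by (subst sum_ennreal[symmetric]) (auto intro!: sum.cong simp: ennreal_mult')
  also have "(\<Sum>j=1..n. w j * (c * (mean_busy j + q j / 2)))
      = c * (\<Sum>j=1..n. w j * (mean_busy j + q j / 2))"
    by (simp add: sum_distrib_left mult_ac)
  finally show ?thesis .
qed

end

subsection \<open>Scheduling policies\<close>

lemma run_fun_upd:
  "j \<notin> fst ` set (run \<pi> u x m) \<Longrightarrow> run \<pi> u (x(j := y)) m = run \<pi> u x m"
  by (induction m) (auto simp: Let_def case_prod_beta)

text \<open>A job's start is decided before its processing time is observed.\<close>

lemma map_of_run_fun_upd:
  assumes "j \<in> fst ` set (run \<pi> u x m)"
  shows "\<exists>s. map_of (run \<pi> u x m) j = Some (s, x j)
    \<and> map_of (run \<pi> u (x(j := y)) m) j = Some (s, y)"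
  using assms
proof (induction m)
  case (Suc m)
  show ?case
  proof (cases "j \<in> fst ` set (run \<pi> u x m)")
    case True
    then show ?thesis using Suc.IH by (auto simp: Let_def map_add_def case_prod_beta)
  next
    case False
    obtain i s where decision: "\<pi> u (run \<pi> u x m) = (i, s)" by fastforce
    then have "i = j" using Suc.prems False by (auto simp: Let_def)
    moreover have "map_of (run \<pi> u x m) j = None" using False by (simp add: map_of_eq_None_iff)
    ultimately show ?thesis
      unfolding run.simps run_fun_upd[OF False] decision Let_def by (simp add: map_add_def)
  qed
qed simp

definition start_time :: "policy \<Rightarrow> real \<Rightarrow> (nat \<Rightarrow> real) \<Rightarrow> nat \<Rightarrow> nat \<Rightarrow> real" where
  "start_time \<pi> u x n j = fst (the (map_of (run \<pi> u x n) j))"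

lemma sum_weighted_starts_ge:
  fixes s y :: "'b \<Rightarrow> real"
  assumes "sorted_wrt (\<lambda>i j. s i + y i \<le> s j) js" "distinct js"
    and "\<And>j. j \<in> set js \<Longrightarrow> l \<le> s j" "\<And>j. j \<in> set js \<Longrightarrow> 0 \<le> y j"
  shows "l * sum y (set js) + ((sum y (set js))\<^sup>2 - (\<Sum>j\<in>set js. (y j)\<^sup>2)) / 2
           \<le> (\<Sum>j\<in>set js. y j * s j)"
  using assms
proof (induction js arbitrary: l)
  case (Cons i js)
  define Y where "Y = sum y (set js)"
  have "(l + y i) * Y + (Y\<^sup>2 - (\<Sum>j\<in>set js. (y j)\<^sup>2)) / 2 \<le> (\<Sum>j\<in>set js. y j * s j)"
    unfolding Y_def using Cons.prems by (intro Cons.IH) force+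
  moreover have "l * y i \<le> y i * s i"
    using Cons.prems(3,4)[of i] by (simp add: mult.commute mult_right_mono)
  ultimately show ?case
    using Cons.prems(2)
    by (simp add: Y_def[symmetric] power2_sum algebra_simps add_divide_distrib diff_divide_distrib)
qed simp

locale seeded_policy =
  fixes n :: nat and r :: "nat \<Rightarrow> real" and \<pi> :: policy and u :: real
  assumes policy: "scheduling_policy n r \<pi>" and seed: "u \<in> {0..1}"
begin

lemma
  assumes "\<And>j. j \<in> {1..n} \<Longrightarrow> 0 \<le> x j"
  shows distinct_run: "distinct (map fst (run \<pi> u x n))"
    and jobs_run: "fst ` set (run \<pi> u x n) = {1..n}"
    and release_le_run: "(j, s, y) \<in> set (run \<pi> u x n) \<Longrightarrow> r j \<le> s"
    and sorted_run: "sorted_wrt (\<lambda>(i, s, y) (j, s', y'). s + y \<le> s') (run \<pi> u x n)"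
proof -
  have "\<forall>j\<in>{1..n}. 0 \<le> x j" using assms by blast
  then have "distinct (map fst (run \<pi> u x n)) \<and> set (map fst (run \<pi> u x n)) = {1..n}
      \<and> (\<forall>(j, s, y)\<in>set (run \<pi> u x n). r j \<le> s)
      \<and> sorted_wrt (\<lambda>(i, s, y) (j, s', y'). s + y \<le> s') (run \<pi> u x n)"
    using policy seed unfolding scheduling_policy_def Let_def by blast
  then show "distinct (map fst (run \<pi> u x n))" "fst ` set (run \<pi> u x n) = {1..n}"
    "(j, s, y) \<in> set (run \<pi> u x n) \<Longrightarrow> r j \<le> s"
    "sorted_wrt (\<lambda>(i, s, y) (j, s', y'). s + y \<le> s') (run \<pi> u x n)" by auto
qed

lemma
  assumes x: "\<And>j. j \<in> {1..n} \<Longrightarrow> 0 \<le> x j" and j: "j \<in> {1..n}"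
  shows completion_eq_start_time: "completion \<pi> u x n j = start_time \<pi> u x n j + x j"
    and start_time_fun_upd: "start_time \<pi> u (x(j := y)) n j = start_time \<pi> u x n j"
    and run_entry: "(j, s, z) \<in> set (run \<pi> u x n) \<Longrightarrow> s = start_time \<pi> u x n j \<and> z = x j"
proof -
  have "j \<in> fst ` set (run \<pi> u x n)" using jobs_run[of x] x j by simp
  note lookup = map_of_run_fun_upd[OF this]
  show "completion \<pi> u x n j = start_time \<pi> u x n j + x j"
    using lookup[of 0] by (auto simp: completion_def start_time_def)
  show "start_time \<pi> u (x(j := y)) n j = start_time \<pi> u x n j"
    using lookup[of y] by (auto simp: start_time_def)
  show "s = start_time \<pi> u x n j \<and> z = x j" if "(j, s, z) \<in> set (run \<pi> u x n)"
    using map_of_is_SomeI[OF distinct_run that] lookup x by (auto simp: start_time_def)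
qed

lemma release_le_start_time:
  assumes x: "\<And>j. j \<in> {1..n} \<Longrightarrow> 0 \<le> x j" and j: "j \<in> {1..n}"
  shows "r j \<le> start_time \<pi> u x n j"
proof -
  have "j \<in> fst ` set (run \<pi> u x n)" using jobs_run[of x] x j by simp
  then obtain s y where "(j, s, y) \<in> set (run \<pi> u x n)" by force
  then show ?thesis using run_entry[of x j s y] release_le_run[of x j s y] x j by simp
qed

lemma sum_weighted_start_times_ge:
  assumes x: "\<And>j. j \<in> {1..n} \<Longrightarrow> 0 \<le> x j" and B: "B \<subseteq> {1..n}" "\<And>j. j \<in> B \<Longrightarrow> l \<le> r j"
  shows "l * sum x B + ((sum x B)\<^sup>2 - (\<Sum>j\<in>B. (x j)\<^sup>2)) / 2 \<le> (\<Sum>j\<in>B. x j * start_time \<pi> u x n j)"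
proof -
  define h where "h = run \<pi> u x n"
  define js where "js = filter (\<lambda>j. j \<in> B) (map fst h)"
  have set: "set js = B" using B(1) jobs_run[of x] x by (auto simp: js_def h_def)
  have entry: "fst (snd e) = start_time \<pi> u x n (fst e) \<and> snd (snd e) = x (fst e)"
    if "e \<in> set h" for e
  proof -
    have "fst e \<in> {1..n}" using that jobs_run[of x] x by (auto simp: h_def)
    then show ?thesis
      using run_entry[of x "fst e" "fst (snd e)" "snd (snd e)"] that x by (simp add: h_def)
  qed
  have "sorted_wrt (\<lambda>i j. start_time \<pi> u x n i + x i \<le> start_time \<pi> u x n j) (map fst h)"
    unfolding sorted_wrt_map
  proof (rule sorted_wrt_mono_rel)
    show "sorted_wrt (\<lambda>(i, s, y) (j, s', y'). s + y \<le> s') h"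
      unfolding h_def by (rule sorted_run[OF x])
  qed (use entry in \<open>auto simp: case_prod_beta\<close>)
  then have "sorted_wrt (\<lambda>i j. start_time \<pi> u x n i + x i \<le> start_time \<pi> u x n j) js"
    unfolding js_def by (rule sorted_wrt_filter)
  moreover have "distinct js" using distinct_run[of x] x by (simp add: js_def h_def)
  moreover have "l \<le> start_time \<pi> u x n j" "0 \<le> x j" if "j \<in> set js" for j
    using that B release_le_start_time[of x j] x B(2)[of j] by (force simp: set)+
  ultimately show ?thesis
    using sum_weighted_starts_ge[of "start_time \<pi> u x n" x js l] by (simp add: set)
qed

end

subsection \<open>Lower bound on the expected cost of a policy\<close>

locale independent_jobs = stochastic_jobs M n r q p for M :: "'a measure" and n r q p +
  assumes indep: "indep_vars (\<lambda>_. borel) p {1..n}"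
begin

text \<open>Processing times are nonnegative only almost surely, and nothing is known about the
  behaviour of a policy on negative ones; hence the truncation.\<close>

definition ptime :: "nat \<Rightarrow> 'a \<Rightarrow> real" where
  "ptime j \<omega> = max 0 (p j \<omega>)"

lemma ptime_nonneg: "0 \<le> ptime j \<omega>"
  by (simp add: ptime_def)

lemma ptime_measurable [measurable]: "j \<in> {1..n} \<Longrightarrow> ptime j \<in> borel_measurable M"
  unfolding ptime_def by measurable

lemma AE_ptime_eq:
  assumes "j \<in> {1..n}"
  shows "AE \<omega> in M. ptime j \<omega> = p j \<omega>"
  using p_nonneg[OF assms] by eventually_elim (simp add: ptime_def)

lemma ptime_integrable: "j \<in> {1..n} \<Longrightarrow> integrable M (ptime j)"
  unfolding ptime_def using p_integrable by auto

lemma expectation_ptime: "j \<in> {1..n} \<Longrightarrow> expectation (ptime j) = q j"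
  using AE_ptime_eq[of j] by (auto simp: q_eq intro!: integral_cong_AE)

lemma nn_integral_ptime: "j \<in> {1..n} \<Longrightarrow> (\<integral>\<^sup>+\<omega>. ennreal (ptime j \<omega>) \<partial>M) = ennreal (q j)"
  using ptime_nonneg by (simp add: nn_integral_eq_integral ptime_integrable expectation_ptime)

lemma indep_vars_ptime: "indep_vars (\<lambda>_. borel) ptime {1..n}"
  using indep_vars_compose2[OF indep, where Y="\<lambda>_. max 0" and N="\<lambda>_. borel"]
  by (simp add: ptime_def[abs_def])

lemma
  assumes "i \<in> {1..n}" "k \<in> {1..n}" "i \<noteq> k"
  shows integrable_ptime_mult: "integrable M (\<lambda>\<omega>. ptime i \<omega> * ptime k \<omega>)"
    and expectation_ptime_mult: "expectation (\<lambda>\<omega>. ptime i \<omega> * ptime k \<omega>) = q i * q k"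
proof -
  have "indep_var borel (ptime i) borel (\<lambda>\<omega>. (\<lambda>k\<in>{1..n} - {i}. ptime k \<omega>) k)"
    using assms by (intro indep_var_restrict_others[OF indep_vars_ptime, where G="\<lambda>x. x k"]) auto
  then have "indep_var borel (ptime i) borel (ptime k)" using assms by simp
  then show "integrable M (\<lambda>\<omega>. ptime i \<omega> * ptime k \<omega>)"
    and "expectation (\<lambda>\<omega>. ptime i \<omega> * ptime k \<omega>) = q i * q k"
    using assms ptime_integrable
    by (simp_all add: indep_var_integrable indep_var_lebesgue_integral expectation_ptime)
qed

lemma sum_ptime_moments:
  assumes "B \<subseteq> {1..n}"
  shows "integrable M (\<lambda>\<omega>. \<Sum>j\<in>B. ptime j \<omega>)"
    and "expectation (\<lambda>\<omega>. \<Sum>j\<in>B. ptime j \<omega>) = sum q B"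
    and "integrable M (\<lambda>\<omega>. \<Sum>i\<in>B. \<Sum>k\<in>B - {i}. ptime i \<omega> * ptime k \<omega>)"
    and "expectation (\<lambda>\<omega>. \<Sum>i\<in>B. \<Sum>k\<in>B - {i}. ptime i \<omega> * ptime k \<omega>)
      = (\<Sum>i\<in>B. \<Sum>k\<in>B - {i}. q i * q k)"
proof -
  have job: "j \<in> {1..n}" if "j \<in> B" for j using that assms by blast
  have single: "integrable M (ptime j)" "expectation (ptime j) = q j" if "j \<in> B" for j
    using ptime_integrable expectation_ptime job[OF that] by auto
  have pair: "integrable M (\<lambda>\<omega>. ptime i \<omega> * ptime k \<omega>)"
    "expectation (\<lambda>\<omega>. ptime i \<omega> * ptime k \<omega>) = q i * q k" if "i \<in> B" "k \<in> B - {i}" for i k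
    using that integrable_ptime_mult[OF job job] expectation_ptime_mult[OF job job] by auto
  have row: "integrable M (\<lambda>\<omega>. \<Sum>k\<in>B - {i}. ptime i \<omega> * ptime k \<omega>)"
    "expectation (\<lambda>\<omega>. \<Sum>k\<in>B - {i}. ptime i \<omega> * ptime k \<omega>) = (\<Sum>k\<in>B - {i}. q i * q k)"
    if "i \<in> B" for i
    using that pair
    by (auto simp: Bochner_Integration.integral_sum intro!: Bochner_Integration.integrable_sum)
  show "integrable M (\<lambda>\<omega>. \<Sum>j\<in>B. ptime j \<omega>)"
    and "integrable M (\<lambda>\<omega>. \<Sum>i\<in>B. \<Sum>k\<in>B - {i}. ptime i \<omega> * ptime k \<omega>)"
    using single row by (auto intro!: Bochner_Integration.integrable_sum)
  show "expectation (\<lambda>\<omega>. \<Sum>j\<in>B. ptime j \<omega>) = sum q B"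
    using single by (simp add: Bochner_Integration.integral_sum)
  show "expectation (\<lambda>\<omega>. \<Sum>i\<in>B. \<Sum>k\<in>B - {i}. ptime i \<omega> * ptime k \<omega>)
      = (\<Sum>i\<in>B. \<Sum>k\<in>B - {i}. q i * q k)"
    using row by (simp add: Bochner_Integration.integral_sum)
qed

end

locale policy_on_jobs = independent_jobs M n r q p + seeded_policy n r \<pi> u
  for M :: "'a measure" and n r q p \<pi> u
begin

definition start :: "nat \<Rightarrow> 'a \<Rightarrow> real" where
  "start j \<omega> = start_time \<pi> u (\<lambda>k\<in>{1..n}. ptime k \<omega>) n j"

lemma start_ge: "j \<in> {1..n} \<Longrightarrow> r j \<le> start j \<omega>"
  unfolding start_def by (rule release_le_start_time) (auto simp: ptime_nonneg)

lemma start_nonneg: "j \<in> {1..n} \<Longrightarrow> 0 \<le> start j \<omega>"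
  using start_ge release_nonneg order_trans by blast

lemma indep_var_ptime_start:
  assumes j: "j \<in> {1..n}"
  shows "indep_var borel (ptime j) borel (start j)"
proof -
  define G where "G = (\<lambda>x. completion \<pi> u (x(j := 0)) n j)"
  have "(\<lambda>x. (u, x(j := 0))) \<in> PiM ({1..n} - {j}) (\<lambda>_. borel)
      \<rightarrow>\<^sub>M borel \<Otimes>\<^sub>M PiM (insert j ({1..n} - {j})) (\<lambda>_. borel)"
    by measurable
  moreover have "(\<lambda>(u, x). completion \<pi> u x n j)
      \<in> borel_measurable (borel \<Otimes>\<^sub>M PiM {1..n} (\<lambda>_. borel))"
    using policy j by (auto simp: scheduling_policy_def)
  ultimately have G: "G \<in> borel_measurable (PiM ({1..n} - {j}) (\<lambda>_. borel))"
    using j unfolding G_def by (auto simp: insert_absorb dest: measurable_compose)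
  have "start j \<omega> = G (\<lambda>k\<in>{1..n} - {j}. ptime k \<omega>)" for \<omega>
  proof -
    let ?x = "\<lambda>k\<in>{1..n}. ptime k \<omega>"
    have "(\<lambda>k\<in>{1..n} - {j}. ptime k \<omega>)(j := 0) = ?x(j := 0)" using j by auto
    moreover have "completion \<pi> u (?x(j := 0)) n j
        = start_time \<pi> u (?x(j := 0)) n j + (?x(j := 0)) j"
      using j by (intro completion_eq_start_time) (auto simp: ptime_nonneg)
    moreover have "start_time \<pi> u (?x(j := 0)) n j = start_time \<pi> u ?x n j"
      using j by (intro start_time_fun_upd) (auto simp: ptime_nonneg)
    ultimately show ?thesis by (simp add: G_def start_def)
  qed
  then have "start j = (\<lambda>\<omega>. G (\<lambda>k\<in>{1..n} - {j}. ptime k \<omega>))" by (rule ext)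
  then show ?thesis using indep_var_restrict_others[OF indep_vars_ptime j G] by (simp only:)
qed

lemma start_measurable [measurable]: "j \<in> {1..n} \<Longrightarrow> start j \<in> borel_measurable M"
  by (rule indep_var_rv2[OF indep_var_ptime_start])

definition mean_start :: "nat \<Rightarrow> ennreal" where
  "mean_start j = (\<integral>\<^sup>+\<omega>. ennreal (start j \<omega>) \<partial>M)"

lemma nn_integral_ptime_start:
  assumes j: "j \<in> {1..n}"
  shows "(\<integral>\<^sup>+\<omega>. ennreal (ptime j \<omega>) * ennreal (start j \<omega>) \<partial>M) = ennreal (q j) * mean_start j"
  using nn_integral_mult_indep_var[OF indep_var_ptime_start[OF j], of ennreal ennreal]
  by (simp add: nn_integral_ptime[OF j] mean_start_def)

lemma sum_ptime_start_ge:
  assumes B: "B \<subseteq> {1..n}" "\<And>j. j \<in> B \<Longrightarrow> l \<le> r j"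
  shows "l * (\<Sum>j\<in>B. ptime j \<omega>) + (\<Sum>i\<in>B. \<Sum>k\<in>B - {i}. ptime i \<omega> * ptime k \<omega>) / 2
    \<le> (\<Sum>j\<in>B. ptime j \<omega> * start j \<omega>)"
proof -
  define x where "x = (\<lambda>k\<in>{1..n}. ptime k \<omega>)"
  have x: "x k = ptime k \<omega>" if "k \<in> B" for k using that B(1) by (auto simp: x_def)
  have "l * sum x B + ((sum x B)\<^sup>2 - (\<Sum>j\<in>B. (x j)\<^sup>2)) / 2 \<le> (\<Sum>j\<in>B. x j * start_time \<pi> u x n j)"
    using B by (intro sum_weighted_start_times_ge) (auto simp: x_def ptime_nonneg)
  then show ?thesis
    using sum_power2_eq_offdiag[of B x] finite_subset[OF B(1)]
    by (simp add: x start_def x_def[symmetric] del: One_nat_def)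
qed

lemma sum_offdiag_le_mean_start:
  assumes B: "B \<subseteq> {1..n}" and l: "0 \<le> l" "\<And>j. j \<in> B \<Longrightarrow> l \<le> r j"
  shows "ennreal (l * sum q B + (\<Sum>i\<in>B. \<Sum>k\<in>B - {i}. q i * q k) / 2)
    \<le> (\<Sum>j\<in>B. ennreal (q j) * mean_start j)"
proof -
  define L where "L = (\<lambda>\<omega>. l * (\<Sum>j\<in>B. ptime j \<omega>)
    + (\<Sum>i\<in>B. \<Sum>k\<in>B - {i}. ptime i \<omega> * ptime k \<omega>) / 2)"
  have n: "j \<in> {1..n}" if "j \<in> B" for j using that B by blast
  have "ennreal (l * sum q B + (\<Sum>i\<in>B. \<Sum>k\<in>B - {i}. q i * q k) / 2) = ennreal (expectation L)"
    using sum_ptime_moments[OF B] by (simp add: L_def)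
  also have "\<dots> = (\<integral>\<^sup>+\<omega>. ennreal (L \<omega>) \<partial>M)"
  proof (rule nn_integral_eq_integral[symmetric])
    show "integrable M L" unfolding L_def using sum_ptime_moments[OF B] by auto
    show "AE \<omega> in M. 0 \<le> L \<omega>"
      using l(1)
      by (auto simp: L_def intro!: add_nonneg_nonneg mult_nonneg_nonneg sum_nonneg ptime_nonneg)
  qed
  also have "\<dots> \<le> (\<integral>\<^sup>+\<omega>. ennreal (\<Sum>j\<in>B. ptime j \<omega> * start j \<omega>) \<partial>M)"
    unfolding L_def by (intro nn_integral_mono ennreal_leI sum_ptime_start_ge B l)
  also have "\<dots> = (\<integral>\<^sup>+\<omega>. (\<Sum>j\<in>B. ennreal (ptime j \<omega>) * ennreal (start j \<omega>)) \<partial>M)"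
    using ptime_nonneg start_nonneg n
    by (intro nn_integral_cong) (simp add: sum_ennreal[symmetric] ennreal_mult)
  also have "\<dots> = (\<Sum>j\<in>B. ennreal (q j) * mean_start j)"
    using n by (subst nn_integral_sum) (auto simp: nn_integral_ptime_start)
  finally show ?thesis .
qed

lemma mbt_feasible_start: "mbt_feasible (\<lambda>j. mean_start j + ennreal (q j / 2))"
  unfolding mbt_feasible_def
proof (intro allI impI)
  fix B and l :: real assume B: "B \<subseteq> {1..n}" and l: "0 \<le> l" "\<forall>j\<in>B. l \<le> r j"
  have fin: "finite B" using B finite_subset by blast
  have q: "0 \<le> q j" if "j \<in> B" for j using that B q_pos[of j] by auto
  have "l * sum q B + (sum q B)\<^sup>2 / 2
      = (l * sum q B + (\<Sum>i\<in>B. \<Sum>k\<in>B - {i}. q i * q k) / 2) + (\<Sum>j\<in>B. q j * (q j / 2))"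
    unfolding sum_power2_eq_offdiag[OF fin]
    by (simp add: add_divide_distrib sum_divide_distrib power2_eq_square)
  also have "ennreal \<dots> = ennreal (l * sum q B + (\<Sum>i\<in>B. \<Sum>k\<in>B - {i}. q i * q k) / 2)
      + (\<Sum>j\<in>B. ennreal (q j) * ennreal (q j / 2))"
    using l(1) q
    by (subst ennreal_plus)
       (auto simp: ennreal_mult[symmetric]
         intro!: add_nonneg_nonneg mult_nonneg_nonneg divide_nonneg_nonneg sum_nonneg)
  also have "\<dots> \<le> (\<Sum>j\<in>B. ennreal (q j) * mean_start j) + (\<Sum>j\<in>B. ennreal (q j) * ennreal (q j / 2))"
    using l by (intro add_right_mono sum_offdiag_le_mean_start B) auto
  finally show "ennreal (l * sum q B + (sum q B)\<^sup>2 / 2)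
      \<le> (\<Sum>j\<in>B. ennreal (q j) * (mean_start j + ennreal (q j / 2)))"
    by (simp add: distrib_left sum.distrib)
qed

lemma nn_integral_weighted_completion:
  assumes w: "\<And>j. j \<in> {1..n} \<Longrightarrow> 0 \<le> w j"
  shows "(\<integral>\<^sup>+\<omega>. ennreal (\<Sum>j=1..n. w j * completion \<pi> u (\<lambda>k\<in>{1..n}. p k \<omega>) n j) \<partial>M)
    = (\<Sum>j=1..n. ennreal (w j) * (mean_start j + ennreal (q j)))"
proof -
  have "AE \<omega> in M. \<forall>k\<in>{1..n}. ptime k \<omega> = p k \<omega>"
    by (intro AE_finite_allI AE_ptime_eq) auto
  then have "AE \<omega> in M. ennreal (\<Sum>j=1..n. w j * completion \<pi> u (\<lambda>k\<in>{1..n}. p k \<omega>) n j)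
      = (\<Sum>j=1..n. ennreal (w j) * (ennreal (start j \<omega>) + ennreal (ptime j \<omega>)))"
  proof eventually_elim
    case (elim \<omega>)
    then have x: "(\<lambda>k\<in>{1..n}. p k \<omega>) = (\<lambda>k\<in>{1..n}. ptime k \<omega>)" by (intro restrict_ext) simp
    have "completion \<pi> u (\<lambda>k\<in>{1..n}. p k \<omega>) n j = start j \<omega> + ptime j \<omega>" if "j \<in> {1..n}" for j
      unfolding x using that
      by (subst completion_eq_start_time) (auto simp: ptime_nonneg start_def)
    then have "ennreal (\<Sum>j=1..n. w j * completion \<pi> u (\<lambda>k\<in>{1..n}. p k \<omega>) n j)
        = ennreal (\<Sum>j=1..n. w j * (start j \<omega> + ptime j \<omega>))" by simp
    also have "\<dots> = (\<Sum>j=1..n. ennreal (w j * (start j \<omega> + ptime j \<omega>)))"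
      using w start_nonneg ptime_nonneg by (intro sum_ennreal[symmetric]) auto
    also have "\<dots> = (\<Sum>j=1..n. ennreal (w j) * (ennreal (start j \<omega>) + ennreal (ptime j \<omega>)))"
      using w start_nonneg ptime_nonneg by (intro sum.cong refl) (simp add: ennreal_mult')
    finally show ?case .
  qed
  then have "(\<integral>\<^sup>+\<omega>. ennreal (\<Sum>j=1..n. w j * completion \<pi> u (\<lambda>k\<in>{1..n}. p k \<omega>) n j) \<partial>M)
      = (\<integral>\<^sup>+\<omega>. (\<Sum>j=1..n. ennreal (w j) * (ennreal (start j \<omega>) + ennreal (ptime j \<omega>))) \<partial>M)"
    by (rule nn_integral_cong_AE)
  also have "\<dots> = (\<Sum>j=1..n. ennreal (w j) * (mean_start j + ennreal (q j)))"
    by (subst nn_integral_sum)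
       (auto simp: nn_integral_cmult nn_integral_add nn_integral_ptime mean_start_def
         intro!: sum.cong)
  finally show ?thesis .
qed

lemma weighted_mean_busy_le_expected_completion:
  assumes w: "\<And>j. j \<in> {1..n} \<Longrightarrow> 0 \<le> w j"
    and w_antimono: "\<And>i j. 1 \<le> i \<Longrightarrow> i \<le> j \<Longrightarrow> j \<le> n \<Longrightarrow> w j / q j \<le> w i / q i"
  shows "ennreal (\<Sum>j=1..n. w j * (mean_busy j + q j / 2))
    \<le> (\<integral>\<^sup>+\<omega>. ennreal (\<Sum>j=1..n. w j * completion \<pi> u (\<lambda>k\<in>{1..n}. p k \<omega>) n j) \<partial>M)"
proof -
  have "(\<Sum>j=1..n. w j * (mean_busy j + q j / 2))
      = (\<Sum>j=1..n. w j * mean_busy j) + (\<Sum>j=1..n. w j * (q j / 2))"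
    by (simp add: distrib_left sum.distrib)
  also have "ennreal \<dots> = ennreal (\<Sum>j=1..n. w j * mean_busy j) + ennreal (\<Sum>j=1..n. w j * (q j / 2))"
    using w mean_busy_nonneg q_pos[THEN less_imp_le]
    by (intro ennreal_plus sum_nonneg mult_nonneg_nonneg) auto
  also have "ennreal (\<Sum>j=1..n. w j * (q j / 2)) = (\<Sum>j=1..n. ennreal (w j) * ennreal (q j / 2))"
    using w q_pos[THEN less_imp_le]
    by (subst sum_ennreal[symmetric], force, intro sum.cong refl ennreal_mult) auto
  also have "ennreal (\<Sum>j=1..n. w j * mean_busy j) + (\<Sum>j=1..n. ennreal (w j) * ennreal (q j / 2))
      \<le> (\<Sum>j=1..n. ennreal (w j) * (mean_start j + ennreal (q j / 2)))
      + (\<Sum>j=1..n. ennreal (w j) * ennreal (q j / 2))"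
    using assms by (intro add_right_mono weighted_mean_busy_le_mbt_feasible mbt_feasible_start)
  also have "\<dots> = (\<Sum>j=1..n. ennreal (w j) * (mean_start j + ennreal (q j)))"
  proof -
    have "ennreal (q j) = ennreal (q j / 2) + ennreal (q j / 2)" if "j \<in> {1..n}" for j
      using q_pos[OF that] by (simp flip: ennreal_plus)
    then show ?thesis by (simp add: sum.distrib[symmetric] distrib_left add.assoc)
  qed
  finally show ?thesis by (simp only: nn_integral_weighted_completion[OF w])
qed

end

lemma (in independent_jobs) weighted_mean_busy_le_policy_cost:
  assumes policy: "scheduling_policy n r \<pi>"
    and w: "\<And>j. j \<in> {1..n} \<Longrightarrow> 0 \<le> w j"
    and w_antimono: "\<And>i j. 1 \<le> i \<Longrightarrow> i \<le> j \<Longrightarrow> j \<le> n \<Longrightarrow> w j / q j \<le> w i / q i"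
  shows "ennreal (\<Sum>j=1..n. w j * (mean_busy j + q j / 2)) \<le> policy_cost n w M p \<pi>"
proof -
  define U where "U = uniform_measure lborel {0..1::real}"
  interpret U: prob_space U unfolding U_def by (intro prob_space_uniform_measure) auto
  have [measurable_cong]: "sets U = sets borel" by (simp add: U_def)
  define cost where "cost = (\<lambda>(u, x). \<Sum>j=1..n. w j * completion \<pi> u x n j)"
  define X where "X \<omega> = (\<lambda>k\<in>{1..n}. p k \<omega>)" for \<omega>
  define LB where "LB = ennreal (\<Sum>j=1..n. w j * (mean_busy j + q j / 2))"
  have [measurable]: "X \<in> M \<rightarrow>\<^sub>M PiM {1..n} (\<lambda>_. borel)"
    unfolding X_def by (intro measurable_restrict) measurable
  have [measurable]: "cost \<in> borel_measurable (borel \<Otimes>\<^sub>M PiM {1..n} (\<lambda>_. borel))"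
    unfolding cost_def case_prod_beta' using policy
    by (intro borel_measurable_sum borel_measurable_times borel_measurable_const)
       (auto simp: scheduling_policy_def case_prod_beta')
  have "LB = (\<integral>\<^sup>+u. LB \<partial>U)" by (simp add: U.emeasure_space_1)
  also have "\<dots> \<le> (\<integral>\<^sup>+u. \<integral>\<^sup>+\<omega>. ennreal (cost (u, X \<omega>)) \<partial>M \<partial>U)"
  proof (rule nn_integral_mono_AE)
    have "AE u in U. u \<in> {0..1}" unfolding U_def by (intro AE_uniform_measureI) auto
    then show "AE u in U. LB \<le> (\<integral>\<^sup>+\<omega>. ennreal (cost (u, X \<omega>)) \<partial>M)"
    proof eventually_elim
      case (elim u)
      interpret policy_on_jobs M n r q p \<pi> u using policy elim by unfold_locales
      show ?case
        using weighted_mean_busy_le_expected_completion[OF w w_antimono]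
        by (simp add: LB_def cost_def X_def)
    qed
  qed
  also have "\<dots> = (\<integral>\<^sup>+z. ennreal (cost (fst z, X (snd z))) \<partial>(U \<Otimes>\<^sub>M M))"
    by (subst nn_integral_fst[symmetric]) auto
  also have "\<dots> = policy_cost n w M p \<pi>"
    by (simp add: policy_cost_def U_def cost_def X_def case_prod_beta')
  finally show ?thesis by (simp add: LB_def)
qed

theorem theorem4:
  fixes M :: "'a measure" and n :: nat and w r :: "nat \<Rightarrow> real"
    and p :: "nat \<Rightarrow> 'a \<Rightarrow> real" and pbar :: "nat \<Rightarrow> real"
    and \<delta> c :: real and f :: "real \<Rightarrow> real"
  assumes "prob_space M"
    and "\<And>j. j \<in> {1..n} \<Longrightarrow> 0 \<le> w j"
    and "\<And>j. j \<in> {1..n} \<Longrightarrow> 0 \<le> r j"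
    and "prob_space.indep_vars M (\<lambda>_. borel) p {1..n}"
    and "\<And>j. j \<in> {1..n} \<Longrightarrow> AE \<omega> in M. 0 \<le> p j \<omega>"
    and "\<And>j. j \<in> {1..n} \<Longrightarrow> integrable M (p j)"
    and "\<And>j. pbar j = (LINT \<omega>|M. p j \<omega>)"
    and "\<And>j. j \<in> {1..n} \<Longrightarrow> 0 < pbar j"
    and "\<And>i j. 1 \<le> i \<Longrightarrow> i \<le> j \<Longrightarrow> j \<le> n \<Longrightarrow> w j / pbar j \<le> w i / pbar i"
    and "1 \<le> \<delta>"
    and "\<And>j. j \<in> {1..n} \<Longrightarrow> delta_NBUE M \<delta> (p j)"
    and "pdf_on_unit f"
    and "\<And>x. x \<in> {0<..1} \<Longrightarrow> (LBINT \<alpha>:{0<..x}. \<delta> / (\<delta> + x - \<alpha>) * f \<alpha>) \<le> (c - 1) * x"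
    and "\<And>x. x \<in> {0<..1} \<Longrightarrow>
           (1 + (LBINT \<alpha>:{0<..1}. \<delta> / (\<delta> + 1 - \<alpha>) * f \<alpha>)) * (LBINT \<alpha>:{1-x<..1}. f \<alpha>) \<le> c * x"
  shows "rsos_cost n w r M p f
           \<le> ennreal (c * (\<Sum>j=1..n. w j * (sp_mean_busy_time r pbar j + pbar j / 2)))
       \<and> (\<forall>OPT. optimal_policy n w r M p OPT \<longrightarrow>
            ennreal (c * (\<Sum>j=1..n. w j * (sp_mean_busy_time r pbar j + pbar j / 2)))
              \<le> ennreal c * policy_cost n w M p OPT)
       \<and> ennreal (c * (\<Sum>j=1..n. w j * (sp_mean_busy_time r pbar j + pbar j / 2)))
            \<le> ennreal c * (INF \<pi>\<in>{\<pi>. scheduling_policy n r \<pi>}. policy_cost n w M p \<pi>)"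
proof -
  interpret prob_space M by fact
  interpret rsos_jobs M n r pbar p f \<delta> c
    using assms by unfold_locales auto
  interpret independent_jobs M n r pbar p
    using assms by unfold_locales auto
  define LB where "LB = (\<Sum>j=1..n. w j * (mean_busy j + pbar j / 2))"
  define INF_cost where "INF_cost = (INF \<pi>\<in>{\<pi>. scheduling_policy n r \<pi>}. policy_cost n w M p \<pi>)"
  have "rsos_cost n w r M p f \<le> ennreal (c * LB)"
    unfolding LB_def using assms(2) by (rule rsos_cost_le)
  moreover have lower: "ennreal LB \<le> policy_cost n w M p \<pi>" if "scheduling_policy n r \<pi>" for \<pi>
    unfolding LB_def using that assms(2,9) by (rule weighted_mean_busy_le_policy_cost)
  then have "ennreal LB \<le> INF_cost"
    unfolding INF_cost_def by (intro INF_greatest) auto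
  moreover have "ennreal (c * LB) \<le> ennreal c * x" if "ennreal LB \<le> x" for x
    using that c_ge_1 by (simp add: ennreal_mult' mult_left_mono)
  ultimately show ?thesis
    using lower by (auto simp: LB_def INF_cost_def optimal_policy_def)
qed

end
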